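(* There exists $n_0$ such that the following holds for every integer $n\ge n_0$ and every real $d$ with $12 \le d \le e^{\sqrt[3]{\log n}}$. Let $G=(V,E)$ be a graph on $|V|=n$ vertices satisfying the following two properties: (P1) for every $S\subset V$ with $|S|\le \frac{n \log\log n \log d}{d\log n \log\log\log n}$ we have $|N(S)|\ge d|S|$; (P2) there is an edge of $G$ between any two disjoint subsets $A,B\subseteq V$ such that $|A|,|B|\ge \frac{n\log\log n\log d}{4130\log n\log\log\log n}$. Then $G$ is Hamilton-connected.
   Context: Graphs are finite and simple. $\log$ is the natural logarithm. For $S\subseteq V$, $N(S)=\{v\in V\setminus S : \exists u\in S,\ (u,v)\in E\}$ is the external neighborhood of $S$. A graph $G=(V,E)$ is Hamilton-connected if for every two distinct vertices $u,v\in V$ there is a Hamilton path (a path through all vertices) in $G$ from $u$ to $v$. *)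

theory Defs
  imports Complex_Main "Graph_Theory.Pair_Digraph" "Graph_Theory.Vertex_Walk"
begin

text \<open>Finite simple graphs are \<open>pair_graph\<close>s: a finite vertex set \<open>pverts G\<close> together with
  an irreflexive symmetric relation \<open>parcs G\<close> on it, so an edge appears in \<open>parcs G\<close> in both
  orientations.\<close>

definition ext_nbhd :: "'a pair_pre_digraph \<Rightarrow> 'a set \<Rightarrow> 'a set" where
  "ext_nbhd G S = {v \<in> pverts G - S. \<exists>u\<in>S. (u, v) \<in> parcs G}"

definition hamilton_path :: "'a pair_pre_digraph \<Rightarrow> 'a \<Rightarrow> 'a list \<Rightarrow> 'a \<Rightarrow> bool" where
  "hamilton_path G u p v \<longleftrightarrow>
     vpath p (with_proj G) \<and> hd p = u \<and> last p = v \<and> set p = pverts G"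

definition hamilton_connected :: "'a pair_pre_digraph \<Rightarrow> bool" where
  "hamilton_connected G \<longleftrightarrow>
     (\<forall>u\<in>pverts G. \<forall>v\<in>pverts G. u \<noteq> v \<longrightarrow> (\<exists>p. hamilton_path G u p v))"

end

theory Submission
  imports Defs "HOL-Real_Asymp.Real_Asymp"
begin

text \<open>Fix distinct vertices \<open>u\<close> and \<open>v\<close> and consider the paths through \<open>uv\<close> in the graph with the
  edge \<open>uv\<close> added.  If some longest such path has adjacent ends, it closes to a cycle, and since the
  graph is connected the cycle is Hamiltonian, for otherwise it could be opened to a longer path
  (\<open>close_longest_uv_path\<close>).  Deleting \<open>uv\<close> gives the Hamilton path from \<open>u\<close> to \<open>v\<close>.  So the task
  is to find a longest path with adjacent ends, and the tool is Posa's rotation: if the last vertex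
  is adjacent to an inner vertex \<open>w\<close>, then reversing the part after \<open>w\<close> gives another longest path,
  in which the successor of \<open>w\<close> has become the last vertex.

  Expansion of small sets multiplies the number of possible ends in each round of rotations, and
  joinedness of moderately large sets takes over when it gets large.  After \<open>T\<close> rounds, with \<open>T\<close> of order
  \<open>log n / log d\<close>, a third of all vertices are ends (\<open>many_endpoints\<close>).  Treating both ends in turn gives
  quadratically many pairs of ends (\<open>many_end_pairs\<close>).  Joinedness does not yet produce an edge
  between the two ends of one of these paths, because the second set of ends depends on
  the first end.

  The way out is that each of these paths arises by at most \<open>2 T\<close> rotations from one path \<open>p\<close>.  Cut
  \<open>p\<close> into \<open>4 T\<close> blocks.  At least half of them survive unbroken, and the rotated path can be cut
  in two with \<open>T\<close> unbroken blocks on either side (\<open>balanced_cut\<close>).  By averaging, there are two families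
  of \<open>l\<close> blocks that lie on the two sides for at least a fraction \<open>64\<^sup>-\<^sup>l\<close> of all pairs of ends.  The
  union of \<open>l\<close> blocks contains a core such that all sets in it of size up to \<open>m\<close> have many neighbours
  among the vertices whose neighbours on \<open>p\<close> lie in the core (\<open>expanding_core\<close>).  Take a pair of ends
  that both have a neighbour among these vertices of their own family, and rotate either end
  using only them as pivots.  These rotations do not disturb one another, and Posa's
  argument yields more than \<open>m\<close> ends on both sides (\<open>local_posa\<close>), which can be combined at will; so
  two of them are adjacent (\<open>join_both_ends\<close>).

  The two demands on \<open>l\<close> are that \<open>l\<close> blocks have a constant multiple of \<open>m\<close> vertices and that
  \<open>64\<^sup>l\<close> is small compared with \<open>n / m\<close>.  As \<open>m\<close> is \<open>n log log n log d / (log n log log log n)\<close>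
  up to a constant, and a block has about \<open>n log d / log n\<close> vertices, the choice
  \<open>l = log log n / log log log n\<close> meets both.  The averaging costs no more than
  \<open>64\<^sup>l\<close> because a family enters through its union alone, in whatever order and orientation its
  blocks appear on the path.\<close>

section \<open>Paths and their edges\<close>

text \<open>Edges are two-element sets, so that reversing a piece of a path, which is what a rotation does,
  leaves its edge set unchanged.\<close>
fun edges :: "'a list \<Rightarrow> 'a set set" where
  "edges (x # y # zs) = insert {x, y} (edges (y # zs))"
| "edges _ = {}"

lemma edges_Cons: "xs \<noteq> [] \<Longrightarrow> edges (x # xs) = insert {x, hd xs} (edges xs)"
  by (cases xs) auto

lemma edges_append:
  "xs \<noteq> [] \<Longrightarrow> ys \<noteq> [] \<Longrightarrow> edges (xs @ ys) = insert {last xs, hd ys} (edges xs \<union> edges ys)"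
proof (induction xs)
  case (Cons x xs)
  then show ?case by (cases "xs = []") (auto simp: edges_Cons)
qed simp

lemma edges_rev [simp]: "edges (rev xs) = edges xs"
proof (induction xs)
  case (Cons x xs)
  then show ?case
    by (cases "xs = []") (auto simp: edges_Cons edges_append last_rev insert_commute)
qed simp

lemma finite_edges [simp]: "finite (edges xs)"
  by (induction xs rule: edges.induct) auto

lemma edges_subset_set: "f \<in> edges xs \<Longrightarrow> f \<subseteq> set xs"
  by (induction xs rule: edges.induct) auto

lemma edges_append_subset: "edges xs \<union> edges ys \<subseteq> edges (xs @ ys)"
  by (cases "xs = []"; cases "ys = []") (auto simp: edges_append)

text \<open>A rotation at the pivot \<open>w\<close> trades the single edge \<open>wx\<close> for the edge from \<open>w\<close> to the old last
  vertex; everything else is the same edge set read in another order.\<close>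
lemma edges_rotate:
  "edges (xs @ w # x # ys) = insert {w, x} (edges (xs @ [w]) \<union> edges (x # ys))"
  "edges (xs @ w # rev (x # ys)) = insert {w, last (x # ys)} (edges (xs @ [w]) \<union> edges (x # ys))"
proof -
  show "edges (xs @ w # x # ys) = insert {w, x} (edges (xs @ [w]) \<union> edges (x # ys))"
    using edges_append[of "xs @ [w]" "x # ys"] by simp
  have "edges ((xs @ [w]) @ rev (x # ys)) = insert {w, last (x # ys)} (edges (xs @ [w]) \<union> edges (x # ys))"
    using edges_append[of "xs @ [w]" "rev (x # ys)"] edges_rev[of "x # ys"]
    by (auto simp: hd_append last_rev hd_rev simp del: edges_rev rev.simps)
  then show "edges (xs @ w # rev (x # ys)) = insert {w, last (x # ys)} (edges (xs @ [w]) \<union> edges (x # ys))"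
    by simp
qed

lemma edge_at_split:
  assumes "distinct (xs @ w # ys)" "{w, z} \<in> edges (xs @ w # ys)"
  shows "(ys \<noteq> [] \<and> z = hd ys) \<or> (xs \<noteq> [] \<and> z = last xs)"
proof -
  have A: "{w, z} \<notin> edges xs" "{w, z} \<notin> edges ys"
    using assms edges_subset_set[of "{w, z}"] by auto
  have "(xs \<noteq> [] \<and> {w, z} = {last xs, w}) \<or> (ys \<noteq> [] \<and> {w, z} = {w, hd ys})"
    using assms(2) A by (cases "xs = []"; cases "ys = []") (simp_all add: edges_append edges_Cons)
  then show ?thesis by (metis doubleton_eq_iff)
qed

text \<open>This is how a pivot is used when a path has already been rotated many times: as long as both
  original edges at \<open>w\<close> are still present, the successor of \<open>w\<close> is one of its two original
  neighbours, whatever the current orientation.\<close>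
lemma successor_among_neighbours:
  assumes "distinct p" "{w, y1} \<in> edges p" "{w, y2} \<in> edges p" "y1 \<noteq> y2" "w \<noteq> last p"
  obtains xs y ys where "p = xs @ w # y # ys" "y = y1 \<or> y = y2"
proof -
  have "w \<in> set p" using assms(2) edges_subset_set by fastforce
  then obtain xs zs where p: "p = xs @ w # zs" by (meson split_list)
  with assms(5) obtain y ys where zs: "zs = y # ys" by (cases zs) auto
  have "y1 = y \<or> xs \<noteq> [] \<and> y1 = last xs" "y2 = y \<or> xs \<noteq> [] \<and> y2 = last xs"
    using edge_at_split[of xs w zs] assms p zs by auto
  with assms(4) have "y = y1 \<or> y = y2" by auto
  with p zs that show ?thesis by blast
qed

lemma path_nbrs:
  assumes "distinct p"
  shows "finite {y. {w, y} \<in> edges p}" "card {y. {w, y} \<in> edges p} \<le> 2"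
proof -
  have "\<exists>a b. {y. {w, y} \<in> edges p} \<subseteq> {a, b}"
  proof (cases "w \<in> set p")
    case True
    then obtain xs ys where "p = xs @ w # ys" by (meson split_list)
    then have "{y. {w, y} \<in> edges p} \<subseteq> {hd ys, last xs}"
      using edge_at_split[of xs w ys] assms by auto
    then show ?thesis by blast
  next
    case False
    then have "{y. {w, y} \<in> edges p} = {}" using edges_subset_set by fastforce
    then show ?thesis by blast
  qed
  then obtain a b where ab: "{y. {w, y} \<in> edges p} \<subseteq> {a, b}" by blast
  then show "finite {y. {w, y} \<in> edges p}" using finite_subset by blast
  have "card {y. {w, y} \<in> edges p} \<le> card {a, b}" using ab by (simp add: card_mono)
  also have "\<dots> \<le> 2" by (simp add: card_insert_if)
  finally show "card {y. {w, y} \<in> edges p} \<le> 2" .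
qed

lemma inner_vertex_two_nbrs:
  assumes "distinct p" "w \<in> set p" "w \<noteq> hd p" "w \<noteq> last p"
  obtains y1 y2 where "y1 \<noteq> y2" "{w, y1} \<in> edges p" "{w, y2} \<in> edges p"
proof -
  obtain xs ys where p: "p = xs @ w # ys" using assms(2) by (meson split_list)
  have ne: "xs \<noteq> []" "ys \<noteq> []" using p assms by auto
  have "{w, last xs} \<in> edges p" "{w, hd ys} \<in> edges p"
    using ne p by (auto simp: edges_append edges_Cons insert_commute)
  moreover have "last xs \<noteq> hd ys" using assms(1) p ne
    by (metis IntI distinct_append disjoint_iff hd_in_set last_in_set list.set_intros(2))
  ultimately show ?thesis using that by metis
qed

text \<open>With \<open>N y\<close> the neighbours of \<open>y\<close> on a path, this is the factor two in Posa's lemma.\<close>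
lemma card_nbhd_le_double:
  assumes "finite S" "\<And>y. y \<in> S \<Longrightarrow> finite (N y) \<and> card (N y) \<le> 2" "A \<subseteq> (\<Union>y\<in>S. N y)"
  shows "card A \<le> 2 * card S"
proof -
  have "card A \<le> card (\<Union>y\<in>S. N y)" using assms by (intro card_mono) auto
  also have "\<dots> \<le> (\<Sum>y\<in>S. card (N y))" using assms(1) by (rule card_UN_le)
  also have "\<dots> \<le> (\<Sum>y\<in>S. 2)" by (intro sum_mono) (use assms in auto)
  finally show ?thesis by simp
qed

section \<open>Rotations and growing sets of endpoints\<close>

text \<open>The graph \<open>(V, X)\<close> is fixed together with the two vertices that a Hamilton path is to connect.
  The pair \<open>uv\<close> may or may not be an edge.\<close>
locale edge_graph =
  fixes V :: "'a set" and X :: "'a set set" and u v :: 'a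
  assumes finite_V: "finite V"
    and edge_ends: "{x, y} \<in> X \<Longrightarrow> x \<in> V \<and> y \<in> V \<and> x \<noteq> y"
    and uv: "u \<in> V" "v \<in> V" "u \<noteq> v"
begin

definition nbh :: "'a set \<Rightarrow> 'a set" where
  "nbh S = {y \<in> V - S. \<exists>x\<in>S. {x, y} \<in> X}"

text \<open>Paths of the graph with \<open>uv\<close> added that run through \<open>uv\<close>.  A Hamilton cycle through \<open>uv\<close> in that
  graph is the same as a Hamilton path from \<open>u\<close> to \<open>v\<close>.\<close>
definition uv_path :: "'a list \<Rightarrow> bool" where
  "uv_path p \<longleftrightarrow> distinct p \<and> set p \<subseteq> V \<and> edges p \<subseteq> insert {u, v} X \<and> {u, v} \<in> edges p"

definition longest_uv_path :: "'a list \<Rightarrow> bool" where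
  "longest_uv_path p \<longleftrightarrow> uv_path p \<and> (\<forall>p'. uv_path p' \<longrightarrow> length p' \<le> length p)"

text \<open>What a sequence of rotations with fixed first vertex preserves.  The relation is also applied to
  a piece of a path that need not contain \<open>uv\<close>, hence the implication in the last clause.\<close>
definition reroute :: "'a list \<Rightarrow> 'a list \<Rightarrow> bool" where
  "reroute p p' \<longleftrightarrow> distinct p' \<and> set p' = set p \<and> hd p' = hd p \<and> edges p' \<subseteq> edges p \<union> X \<and>
     ({u, v} \<in> edges p \<longrightarrow> {u, v} \<in> edges p')"

lemma reroute_refl: "distinct p \<Longrightarrow> reroute p p"
  by (auto simp: reroute_def)

lemma reroute_trans: "reroute p q \<Longrightarrow> reroute q r \<Longrightarrow> reroute p r"
  by (auto simp: reroute_def)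

lemma uv_path_reroute: "uv_path p \<Longrightarrow> reroute p p' \<Longrightarrow> uv_path p'"
  by (auto simp: reroute_def uv_path_def)

lemma length_reroute: "distinct p \<Longrightarrow> reroute p p' \<Longrightarrow> length p' = length p"
  by (metis distinct_card reroute_def)

lemma longest_uv_path_reroute: "longest_uv_path p \<Longrightarrow> reroute p p' \<Longrightarrow> longest_uv_path p'"
  unfolding longest_uv_path_def by (metis uv_path_reroute length_reroute uv_path_def)

lemma uv_path_rev: "uv_path (rev p) \<longleftrightarrow> uv_path p"
  by (auto simp: uv_path_def)

lemma longest_uv_path_rev: "longest_uv_path p \<Longrightarrow> longest_uv_path (rev p)"
  by (simp add: longest_uv_path_def uv_path_rev)

text \<open>Requiring the pivot to avoid \<open>u\<close> and \<open>v\<close> makes sure that \<open>uv\<close> is never the edge that is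
  broken.\<close>
lemma rotate:
  assumes "distinct p" "p = xs @ w # y # ys" "{last p, w} \<in> X" "w \<noteq> u" "w \<noteq> v"
  defines "p' \<equiv> xs @ w # rev (y # ys)"
  shows "reroute p p'" "last p' = y" "edges p \<subseteq> insert {w, y} (edges p')"
proof -
  have l: "last p = last (y # ys)" using assms by simp
  have e1: "edges p = insert {w, y} (edges (xs @ [w]) \<union> edges (y # ys))"
    using assms(2) edges_rotate(1)[of xs w y ys] by simp
  have e2: "edges p' = insert {w, last p} (edges (xs @ [w]) \<union> edges (y # ys))"
    unfolding p'_def l using edges_rotate(2)[of xs w y ys] by simp
  have e3: "{w, last p} \<in> X" using assms(3) by (simp add: insert_commute)
  have e4: "{u, v} \<noteq> {w, y}" using assms(4,5) by (auto simp: doubleton_eq_iff)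
  have h: "hd p' = hd p" unfolding p'_def assms(2) by (simp add: hd_append)
  show "reroute p p'"
    unfolding reroute_def using assms(1) h e1 e2 e3 e4
    by (auto simp: p'_def assms(2))
  show "last p' = y" by (simp add: p'_def)
  show "edges p \<subseteq> insert {w, y} (edges p')" using e1 e2 by auto
qed

text \<open>A neighbour outside the path of an endpoint would extend a longest path.\<close>
lemma nbh_longest:
  assumes "longest_uv_path p" "\<And>x. x \<in> S \<Longrightarrow> \<exists>p'. reroute p p' \<and> last p' = x"
  shows "nbh S \<subseteq> set p"
proof
  fix y assume "y \<in> nbh S"
  then obtain x where x: "x \<in> S" "{x, y} \<in> X" "y \<in> V" by (auto simp: nbh_def)
  then obtain p' where p': "reroute p p'" "last p' = x" using assms by blast
  then have l: "longest_uv_path p'" using assms(1) longest_uv_path_reroute by blast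
  show "y \<in> set p"
  proof (rule ccontr)
    assume "y \<notin> set p"
    then have y: "y \<notin> set p'" using p' by (simp add: reroute_def)
    have "p' \<noteq> []" using l by (auto simp: longest_uv_path_def uv_path_def)
    then have "uv_path (p' @ [y])"
      using l y x p' by (auto simp: longest_uv_path_def uv_path_def edges_append)
    then show False using l unfolding longest_uv_path_def by fastforce
  qed
qed

text \<open>After \<open>t\<close> rounds of rotations \<open>S\<close> holds the newest endpoints and \<open>U\<close> all endpoints met so far.
  Every broken edge of \<open>p\<close> meets \<open>U\<close>, because the edge broken by a rotation contains the endpoint
  that the rotation creates.\<close>
definition layer :: "'a list \<Rightarrow> 'a set \<Rightarrow> 'a set \<Rightarrow> nat \<Rightarrow> bool" where
  "layer p S U t \<longleftrightarrow> S \<subseteq> U \<and> U \<subseteq> set p \<and> last p \<in> U \<and>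
     (\<forall>x\<in>S. \<exists>p'. reroute p p' \<and> last p' = x \<and> card (edges p - edges p') \<le> t \<and>
        (\<forall>f\<in>edges p - edges p'. f \<inter> U \<noteq> {}))"

text \<open>A neighbour \<open>w\<close> of \<open>S\<close> with neither \<open>w\<close> nor its two neighbours on \<open>p\<close> in \<open>U\<close> still has both of its
  \<open>p\<close>-edges, so it is a pivot whose rotation makes one of these neighbours a new endpoint.  The
  exclusions cost at most \<open>3 |U| + 3\<close> vertices, and two pivots at most share an endpoint.\<close>
lemma next_layer:
  assumes L: "layer p S U t" and d: "distinct p" and nb: "nbh S \<subseteq> set p"
    and c: "2 * c + 3 * card U + 3 \<le> card (nbh S)"
  obtains S' where "card S' = c" "S' \<inter> U = {}" "layer p S' (U \<union> S') (Suc t)"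
proof -
  define nbr where "nbr y = {w. {y, w} \<in> edges p}" for y
  have nbr: "finite (nbr y)" "card (nbr y) \<le> 2" for y
    unfolding nbr_def by (rule path_nbrs[OF d])+
  have nbr_sym: "w \<in> nbr y \<longleftrightarrow> {w, y} \<in> edges p" for w y by (simp add: nbr_def insert_commute)
  have fU: "finite U" using L by (meson List.finite_set finite_subset layer_def)
  \<comment> \<open>\<open>W\<close> collects the pivots, \<open>Y\<close> the endpoints that one further rotation produces.\<close>
  define W where "W = nbh S - (U \<union> (\<Union>y\<in>U. nbr y) \<union> {hd p, u, v})"
  define good where "good y p' \<longleftrightarrow> reroute p p' \<and> last p' = y \<and> card (edges p - edges p') \<le> Suc t \<and>
        (\<forall>f\<in>edges p - edges p'. f \<inter> insert y U \<noteq> {})" for y p'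
  define Y where "Y = {y \<in> set p - U. \<exists>p'. good y p'}"
  have fY: "finite Y" by (simp add: Y_def)
  have W: "\<exists>y\<in>Y. w \<in> nbr y" if w: "w \<in> W" for w
  proof -
    obtain x where x: "x \<in> S" "{x, w} \<in> X" using w by (auto simp: W_def nbh_def)
    obtain p' where p': "reroute p p'" "last p' = x" "card (edges p - edges p') \<le> t"
      "\<forall>f\<in>edges p - edges p'. f \<inter> U \<noteq> {}" using L x by (auto simp: layer_def)
    have "w \<in> set p" "w \<noteq> hd p" "w \<noteq> last p" "w \<notin> U" "w \<noteq> u" "w \<noteq> v"
      using w nb L by (auto simp: W_def layer_def)
    note w' = this
    obtain y1 y2 where y: "y1 \<noteq> y2" "{w, y1} \<in> edges p" "{w, y2} \<in> edges p"
      using inner_vertex_two_nbrs[OF d w'(1-3)] .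
    have yU: "y1 \<notin> U" "y2 \<notin> U" using y w nbr_sym by (auto simp: W_def)
    have y': "{w, y1} \<in> edges p'" "{w, y2} \<in> edges p'"
      using bspec[OF p'(4), of "{w, y1}"] bspec[OF p'(4), of "{w, y2}"] y(2,3) yU w'(4) by blast+
    have d': "distinct p'" using p' by (simp add: reroute_def)
    have "w \<noteq> last p'" using edge_ends x p' by auto
    then obtain xs z ys where z: "p' = xs @ w # z # ys" "z = y1 \<or> z = y2"
      using successor_among_neighbours[OF d' y'(1) y'(2) y(1)] by metis
    have lw: "{last p', w} \<in> X" using x p' by simp
    let ?q = "xs @ w # rev (z # ys)"
    note r = rotate[OF d' z(1) lw w'(5) w'(6)]
    have zU: "z \<notin> U" using z yU by auto
    have zp: "{w, z} \<in> edges p" using z y by auto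
    then have zs: "z \<in> set p" using edges_subset_set by fastforce
    have sub: "edges p - edges ?q \<subseteq> insert {w, z} (edges p - edges p')" using r(3) by auto
    have "card (edges p - edges ?q) \<le> card (insert {w, z} (edges p - edges p'))"
      by (intro card_mono sub) simp
    also have "\<dots> \<le> Suc t" using p'(3) by (simp add: card_insert_if)
    finally have "good z ?q"
      unfolding good_def using reroute_trans[OF p'(1) r(1)] r(2) sub p'(4) by blast
    then have "z \<in> Y" using zU zs by (auto simp: Y_def)
    then show ?thesis using zp nbr_sym by auto
  qed
  have "card (nbh S) \<le> card (W \<union> (U \<union> (\<Union>y\<in>U. nbr y) \<union> {hd p, u, v}))"
    by (rule card_mono) (use nb fU nbr in \<open>auto simp: W_def intro: finite_subset[OF nb]\<close>)
  also have "\<dots> \<le> card W + (card U + card (\<Union>y\<in>U. nbr y) + card {hd p, u, v})"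
    by (meson add_mono card_Un_le le_refl order_trans)
  also have "card (\<Union>y\<in>U. nbr y) \<le> 2 * card U"
    using card_nbhd_le_double[OF fU, of nbr] nbr by blast
  also have "card {hd p, u, v} \<le> 3" by (simp add: card_insert_if)
  finally have "2 * c \<le> card W" using c by linarith
  also have "card W \<le> 2 * card Y"
    by (rule card_nbhd_le_double[OF fY, of nbr]) (use nbr W in auto)
  finally obtain S' where S': "S' \<subseteq> Y" "card S' = c"
    by (meson mult_le_cancel1 obtain_subset_with_card_n zero_less_numeral)
  have "layer p S' (U \<union> S') (Suc t)"
    unfolding layer_def
  proof (intro conjI ballI)
    fix x assume "x \<in> S'"
    then obtain p' where "good x p'" using S' by (auto simp: Y_def)
    then show "\<exists>p'. reroute p p' \<and> last p' = x \<and> card (edges p - edges p') \<le> Suc t \<and>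
         (\<forall>f\<in>edges p - edges p'. f \<inter> (U \<union> S') \<noteq> {})"
    proof (intro exI[of _ p'] conjI ballI)
      fix f assume "f \<in> edges p - edges p'"
      then have "f \<inter> insert x U \<noteq> {}" using \<open>good x p'\<close> unfolding good_def by blast
      then show "f \<inter> (U \<union> S') \<noteq> {}" using \<open>x \<in> S'\<close> by blast
    qed (use \<open>good x p'\<close> in \<open>simp_all add: good_def\<close>)
  qed (use L S' in \<open>auto simp: layer_def Y_def\<close>)
  then show ?thesis using that S' by (auto simp: Y_def)
qed

end

text \<open>The factor \<open>4\<close> leaves room for the losses of a round of rotations, which multiplies the number of
  endpoints by \<open>D\<close>.  The last two conditions make the expansion reach size \<open>m\<close> and keep sets of
  size \<open>k\<close> or \<open>m\<close> small within \<open>V\<close>.\<close>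
locale expander = edge_graph +
  fixes D k m :: nat
  assumes D: "3 \<le> D" and m: "1 \<le> m"
    and expand: "S \<subseteq> V \<Longrightarrow> card S \<le> k \<Longrightarrow> 4 * D * card S \<le> card (nbh S)"
    and joined: "A \<subseteq> V \<Longrightarrow> B \<subseteq> V \<Longrightarrow> A \<inter> B = {} \<Longrightarrow> m \<le> card A \<Longrightarrow> m \<le> card B \<Longrightarrow>
       \<exists>a\<in>A. \<exists>b\<in>B. {a, b} \<in> X"
    and Dk: "2 * m + 2 \<le> D * k"
    and size: "24 * k + 15 * m + 20 \<le> card V"
begin

lemma k_pos: "1 \<le> k" using Dk by (cases k) auto

lemma nonneighbours_few:
  assumes "A \<subseteq> V" "m \<le> card A" "B \<subseteq> V" "B \<inter> A = {}"
  shows "card (B - nbh A) < m"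
proof (rule ccontr)
  assume "\<not> ?thesis"
  moreover have "B - nbh A \<subseteq> V" "A \<inter> (B - nbh A) = {}" using assms by auto
  ultimately obtain a b where "a \<in> A" "b \<in> B - nbh A" "{a, b} \<in> X"
    using joined[of A "B - nbh A"] assms by auto
  then show False using assms by (auto simp: nbh_def)
qed

lemma finite_sub: "S \<subseteq> V \<Longrightarrow> finite S" using finite_V finite_subset by blast

text \<open>The endpoints multiply by \<open>D\<close> in each round: of an expansion by \<open>4 D\<close>, half is lost by the two to
  one count of endpoints, and the old endpoints are a geometric sum of at most
  \<open>(3 D\<^sup>t - 1) / 2\<close>, which costs at most another \<open>2 D\<^sup>t\<^sup>+\<^sup>1\<close> pivots as \<open>D \<ge> 3\<close>.\<close>
lemma power_layer:
  assumes p: "longest_uv_path p" and t: "D ^ t \<le> k"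
  shows "\<exists>S U. layer p S U t \<and> card S = D ^ t \<and> 2 * card U + 1 \<le> 3 * D ^ t"
  using t
proof (induction t)
  case 0
  have d: "distinct p" "p \<noteq> []" using p by (auto simp: longest_uv_path_def uv_path_def)
  have "layer p {last p} {last p} 0"
    using reroute_refl[OF d(1)] d by (auto simp: layer_def)
  then show ?case by (intro exI[of _ "{last p}"]) simp
next
  case (Suc t)
  have Dt: "1 \<le> D ^ t" "3 * D ^ t \<le> D * D ^ t" using D by auto
  with Suc.prems have "D ^ t \<le> k" unfolding power_Suc by linarith
  with Suc.IH obtain S U where L: "layer p S U t" "card S = D ^ t" "2 * card U + 1 \<le> 3 * D ^ t" by blast
  have V: "set p \<subseteq> V" "distinct p" using p by (auto simp: longest_uv_path_def uv_path_def)
  have SV: "S \<subseteq> V" "U \<subseteq> set p" using L(1) V by (auto simp: layer_def)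
  have nb: "nbh S \<subseteq> set p" by (rule nbh_longest[OF p]) (use L in \<open>auto simp: layer_def\<close>)
  have "2 * D ^ Suc t + 3 * card U + 3 \<le> 4 * D * card S"
    unfolding L(2) power_Suc mult.assoc using L(3) Dt by linarith
  also have "\<dots> \<le> card (nbh S)" using expand[OF SV(1)] L \<open>D ^ t \<le> k\<close> by simp
  finally obtain S' where S': "card S' = D ^ Suc t" "S' \<inter> U = {}" "layer p S' (U \<union> S') (Suc t)"
    using next_layer[OF L(1) V(2) nb, of "D ^ Suc t"] by blast
  have "card (U \<union> S') \<le> card U + card S'" by (rule card_Un_le)
  then have "2 * card (U \<union> S') + 1 \<le> 3 * D ^ Suc t"
    using S'(1) L(3) Dt unfolding power_Suc by linarith
  then show ?case using S' by blast
qed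

text \<open>Layers of size \<open>D\<^sup>i\<close> are continued up to \<open>k\<close>; three more rounds bring the size to \<open>k\<close>, to
  \<open>m\<close> and, as almost every vertex is a neighbour of a set of size \<open>m\<close>, to a third of all
  vertices.  This takes about \<open>log k / log D\<close> rotations, so only that many edges of \<open>p\<close> are
  broken.\<close>
lemma many_endpoints:
  assumes p: "longest_uv_path p" and T: "k < D ^ (T - 2)" 
  obtains B where "card B = card V div 3" 
    "\<And>b. b \<in> B \<Longrightarrow> \<exists>p'. reroute p p' \<and> last p' = b \<and> card (edges p - edges p') \<le> T"
proof -
  have V: "set p \<subseteq> V" "distinct p" using p by (auto simp: longest_uv_path_def uv_path_def)
  have inV: "S \<subseteq> V" "nbh S \<subseteq> set p" if "layer p S U t" for S U t
    using V that nbh_longest[OF p, of S] unfolding layer_def by blast+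
  obtain t where t: "D ^ t \<le> k" "k < D ^ Suc t" "t < T - 2"
    using ex_least_nat_less[of "\<lambda>i. k < D ^ i" "T - 2"] T k_pos by (auto simp: not_less)
  have Dt: "1 \<le> D ^ t" "3 * D ^ t \<le> D * D ^ t" "3 * k \<le> D * k" using D by auto
  obtain S U where L: "layer p S U t" "card S = D ^ t" "2 * card U + 1 \<le> 3 * D ^ t"
    using power_layer[OF p t(1)] by blast
  have "2 * k + 3 * card U + 3 \<le> 4 * D * card S"
    using L(3) Dt t(2) unfolding L(2) power_Suc mult.assoc by linarith
  also have "\<dots> \<le> card (nbh S)" using expand[OF inV(1)[OF L(1)]] L t by simp
  finally obtain S1 where S1: "card S1 = k" "layer p S1 (U \<union> S1) (Suc t)"
    using next_layer[OF L(1) V(2) inV(2)[OF L(1)], of k] by blast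
  have U1: "card (U \<union> S1) \<le> card U + k" using card_Un_le[of U S1] S1 by simp
  have "2 * m + 3 * card (U \<union> S1) + 3 \<le> 4 * D * card S1"
    using U1 L(3) Dt t(1) Dk unfolding S1(1) mult.assoc by linarith
  also have "\<dots> \<le> card (nbh S1)" using expand[OF inV(1)[OF S1(2)]] S1 by simp
  finally obtain S2 where S2: "card S2 = m" "layer p S2 (U \<union> S1 \<union> S2) (Suc (Suc t))"
    using next_layer[OF S1(2) V(2) inV(2)[OF S1(2)], of m] by blast
  have U2: "card (U \<union> S1 \<union> S2) \<le> card (U \<union> S1) + m" using card_Un_le[of "U \<union> S1" S2] S2 by simp
  have S2V: "S2 \<subseteq> V" using inV(1)[OF S2(2)] .
  have "card V \<le> card (S2 \<union> (nbh S2 \<union> ((V - S2) - nbh S2)))"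
    by (rule card_mono) (use finite_V S2V in \<open>auto intro: finite_sub simp: nbh_def\<close>)
  also have "\<dots> \<le> card S2 + (card (nbh S2) + card ((V - S2) - nbh S2))"
    by (meson add_mono card_Un_le le_refl order_trans)
  also have "card ((V - S2) - nbh S2) \<le> m"
    using nonneighbours_few[OF S2V, of "V - S2"] S2 by (simp add: Diff_Int_distrib2)
  finally have "card V \<le> card (nbh S2) + 2 * m" using S2 by simp
  then have "2 * (card V div 3) + 3 * card (U \<union> S1 \<union> S2) + 3 \<le> card (nbh S2)"
    using U2 U1 L(3) t(1) size by linarith
  then obtain B where B: "card B = card V div 3" "layer p B (U \<union> S1 \<union> S2 \<union> B) (Suc (Suc (Suc t)))"
    using next_layer[OF S2(2) V(2) inV(2)[OF S2(2)], of "card V div 3"] by blast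
  show ?thesis
  proof (rule that[OF B(1)])
    fix b assume "b \<in> B"
    then obtain p' where "reroute p p'" "last p' = b" "card (edges p - edges p') \<le> Suc (Suc (Suc t))"
      using B(2) by (auto simp: layer_def)
    moreover have "Suc (Suc (Suc t)) \<le> T" using t by linarith
    ultimately show "\<exists>p'. reroute p p' \<and> last p' = b \<and> card (edges p - edges p') \<le> T"
      using le_trans by blast
  qed
qed

end

section \<open>Blocks of a path\<close>

lemma edge_split:
  assumes "f \<in> edges p"
  obtains xs a b ys where "p = xs @ a # b # ys" "f = {a, b}"
  using assms
proof (induction p arbitrary: thesis rule: edges.induct)
  case (1 x y zs)
  show ?case
  proof (cases "f = {x, y}")
    case True
    then show ?thesis using "1.prems"(1)[of "[]" x y zs] by simp
  next
    case False
    then have "f \<in> edges (y # zs)" using "1.prems"(2) by simp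
    then obtain xs a b ys where "y # zs = xs @ a # b # ys" "f = {a, b}" using "1.IH" by blast
    then show ?thesis using "1.prems"(1)[of "x # xs" a b ys] by simp
  qed
qed auto

lemma edge_nonempty: "f \<in> edges p \<Longrightarrow> f \<noteq> {}"
  by (metis edge_split insert_not_empty)

lemma edges_left_part:
  assumes "distinct (p1 @ p2)" "f \<in> edges (p1 @ p2)" "f \<subseteq> set p1"
  shows "f \<in> edges p1"
proof (cases "p1 = [] \<or> p2 = []")
  case True
  then show ?thesis using assms edge_nonempty[OF assms(2)] by auto
next
  case False
  have "f \<notin> edges p2" using edges_subset_set[of f p2] edge_nonempty[OF assms(2)] assms by auto
  moreover have "f \<noteq> {last p1, hd p2}" using assms False by auto
  ultimately show ?thesis using assms(2) False by (auto simp: edges_append)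
qed

lemma edges_right_part:
  assumes "distinct (p1 @ p2)" "f \<in> edges (p1 @ p2)" "f \<subseteq> set p2"
  shows "f \<in> edges p2"
  using edges_left_part[of "rev p2" "rev p1" f] assms edges_rev[of "p1 @ p2"] by auto

lemma no_jump_over_vertex:
  assumes "distinct (A @ x # B)" "y \<in> set A" "z \<in> set B"
  shows "{y, z} \<notin> edges (A @ x # B)"
proof -
  have n: "y \<noteq> x" "z \<noteq> x" "y \<notin> set B" "z \<notin> set A" using assms by auto
  then have n': "{y, z} \<notin> edges A" "{y, z} \<notin> edges B"
    using edges_subset_set[of "{y, z}"] by blast+
  have "A \<noteq> []" "B \<noteq> []" using assms by auto
  then have "edges (A @ x # B) = {{last A, x}, {x, hd B}} \<union> edges A \<union> edges B"
    by (auto simp: edges_append edges_Cons)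
  then show ?thesis using n n' by (auto simp: doubleton_eq_iff)
qed

text \<open>A piece that is connected by edges of the path and misses a vertex \<open>x\<close> cannot lie on both sides
  of \<open>x\<close>.\<close>
lemma connected_part_one_side:
  assumes "distinct (A @ x # B)" "edges s \<subseteq> edges (A @ x # B)" "set s \<subseteq> set (A @ x # B)" "x \<notin> set s"
  shows "set s \<subseteq> set A \<or> set s \<subseteq> set B"
  using assms
proof (induction s rule: edges.induct)
  case (1 y z zs)
  have IH: "set (z # zs) \<subseteq> set A \<or> set (z # zs) \<subseteq> set B" using "1.IH" "1.prems" by auto
  have f: "{y, z} \<in> edges (A @ x # B)" "{z, y} \<in> edges (A @ x # B)"
    using "1.prems"(2) by (auto simp: insert_commute)
  have "y \<in> set A \<union> set B" using "1.prems" by auto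
  then show ?case
    using IH f no_jump_over_vertex[OF "1.prems"(1)] by auto
qed auto

text \<open>Move a cut along \<open>q\<close>.  Each step passes one vertex, and since the pieces are disjoint and connected,
  at most one of them is neither behind nor ahead of that vertex.  At the step that brings the number
  of pieces behind the cut up to \<open>a\<close>, fewer than \<open>a\<close> were behind before, so all but \<open>a\<close> are ahead.\<close>
lemma balanced_cut:
  fixes seg :: "'b \<Rightarrow> 'a list"
  assumes q: "distinct q" and I: "finite I" "a + b \<le> card I"
    and seg: "\<And>i. i \<in> I \<Longrightarrow> seg i \<noteq> [] \<and> set (seg i) \<subseteq> set q \<and> edges (seg i) \<subseteq> edges q"
    and disj: "\<And>i j. i \<in> I \<Longrightarrow> j \<in> I \<Longrightarrow> i \<noteq> j \<Longrightarrow> set (seg i) \<inter> set (seg j) = {}"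
  obtains p1 p2 where "q = p1 @ p2" "a \<le> card {i \<in> I. set (seg i) \<subseteq> set p1}"
    "b \<le> card {i \<in> I. set (seg i) \<subseteq> set p2}"
proof -
  define f where "f j = card {i \<in> I. set (seg i) \<subseteq> set (take j q)}" for j
  show ?thesis
  proof (cases "a = 0")
    case True
    have "{i \<in> I. set (seg i) \<subseteq> set q} = I" using seg by auto
    then show ?thesis using that[of "[]" q] True I by auto
  next
    case False
    have none: "{i \<in> I. set (seg i) \<subseteq> {}} = {}" using seg by auto
    have "f 0 = 0" unfolding f_def take_0 list.set(1) none by simp
    moreover have "{i \<in> I. set (seg i) \<subseteq> set q} = I" using seg by auto
    then have "a \<le> f (length q)" using I by (simp add: f_def)
    ultimately obtain j where j: "j < length q" "f j < a" "a \<le> f (Suc j)"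
      using ex_least_nat_less[of "\<lambda>j. a \<le> f j" "length q"] False by (auto simp: not_le)
    \<comment> \<open>the vertex \<open>q ! j\<close> is the one whose passing brings the count up to \<open>a\<close>\<close>
    have q': "q = take j q @ q ! j # drop (Suc j) q" using j(1) by (rule id_take_nth_drop)
    define J1 where "J1 = {i \<in> I. set (seg i) \<subseteq> set (take j q)}"
    define J2 where "J2 = {i \<in> I. set (seg i) \<subseteq> set (drop (Suc j) q)}"
    define J3 where "J3 = {i \<in> I. q ! j \<in> set (seg i)}"
    have "I \<subseteq> J1 \<union> J2 \<union> J3"
    proof
      fix i assume i: "i \<in> I"
      show "i \<in> J1 \<union> J2 \<union> J3"
        using connected_part_one_side[of "take j q" "q ! j" "drop (Suc j) q" "seg i"] q q' seg[OF i] i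
        by (auto simp: J1_def J2_def J3_def)
    qed
    then have "card I \<le> card (J1 \<union> J2 \<union> J3)" using I by (intro card_mono) (auto simp: J1_def J2_def J3_def)
    also have "\<dots> \<le> card J1 + card J2 + card J3"
      by (meson add_mono card_Un_le le_refl order_trans)
    also have "card J3 \<le> 1"
    proof -
      have "i = i'" if "i \<in> J3" "i' \<in> J3" for i i' using that disj by (fastforce simp: J3_def)
      then show ?thesis by (simp add: card_le_Suc0_iff_eq J3_def I)
    qed
    finally have "b \<le> card J2" using j(2) I(2) by (simp add: f_def J1_def)
    then show ?thesis using that[of "take (Suc j) q" "drop (Suc j) q"] j(3) by (simp add: f_def J2_def)
  qed
qed

lemma double_count:
  assumes "finite R" "finite K" "\<And>r. r \<in> R \<Longrightarrow> N \<le> card {c \<in> K. P r c}" "card K * B < card R * N"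
  obtains c where "c \<in> K" "B < card {r \<in> R. P r c}"
proof (rule ccontr)
  assume "\<not> thesis"
  then have le: "\<And>c. c \<in> K \<Longrightarrow> card {r \<in> R. P r c} \<le> B" using that by (meson not_le)
  have "card R * N \<le> (\<Sum>r\<in>R. card {c \<in> K. P r c})" using assms(3) sum_bounded_below[of R N] by simp
  also have "\<dots> = (\<Sum>c\<in>K. card {r \<in> R. P r c})" by (rule sum_multicount_gen) (use assms in auto)
  also have "\<dots> \<le> card K * B" using le sum_bounded_above[of K _ B] by simp
  finally show False using assms(4) by simp
qed

lemma many_distinct_lists:
  assumes "finite A" "r + l \<le> card A"
  shows "r ^ l \<le> card {xs. length xs = l \<and> distinct xs \<and> set xs \<subseteq> A}"
proof -
  have "r ^ l = (\<Prod>i\<in>{card A - l + 1..card A}. r)" using assms(2) by simp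
  also have "\<dots> \<le> \<Prod>{card A - l + 1..card A}" using assms(2) by (intro prod_mono) auto
  finally show ?thesis using card_lists_distinct_length_eq[of A l] assms by simp
qed

definition block :: "'a list \<Rightarrow> nat \<Rightarrow> nat \<Rightarrow> 'a list" where
  "block p L i = take L (drop (i * L) p)"

context
  fixes p :: "'a list" and L M :: nat
  assumes p: "distinct p" and fit: "M * L \<le> length p"
begin

lemma block_split: "p = take (i * L) p @ block p L i @ drop L (drop (i * L) p)"
  by (simp only: block_def append_take_drop_id)

lemma distinct_block: "distinct (block p L i)" using p by (simp add: block_def)

lemma set_block_subset: "set (block p L i) \<subseteq> set p"
  by (metis block_def set_drop_subset set_take_subset subset_trans)

lemma edges_block_subset: "edges (block p L i) \<subseteq> edges p"
  using block_split[of i] edges_append_subset[of "take (i * L) p"] edges_append_subset[of "block p L i"]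
  by (metis Un_subset_iff subset_trans)

lemma block_fits: "i < M \<Longrightarrow> Suc i * L \<le> length p"
  using fit by (meson Suc_leI le_trans mult_le_mono1)

lemma length_block: "i < M \<Longrightarrow> length (block p L i) = L"
  using block_fits[of i] by (simp add: block_def)

lemma set_block: "i < M \<Longrightarrow> set (block p L i) = (!) p ` {i * L..<Suc i * L}"
proof -
  assume i: "i < M"
  have "set (block p L i) = (!) (block p L i) ` {0..<L}"
    using length_block[OF i] by (auto simp: set_conv_nth)
  also have "\<dots> = (\<lambda>j. p ! (i * L + j)) ` {0..<L}"
    by (rule image_cong) (use block_fits[OF i] in \<open>auto simp: block_def\<close>)
  also have "\<dots> = (!) p ` ((+) (i * L) ` {0..<L})" by (simp only: image_image)
  also have "(+) (i * L) ` {0..<L} = {i * L..<Suc i * L}" by (simp add: add.commute)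
  finally show ?thesis .
qed

lemma blocks_disjoint:
  assumes "i < M" "j < M" "i \<noteq> j"
  shows "set (block p L i) \<inter> set (block p L j) = {}"
proof -
  have *: "set (block p L i) \<inter> set (block p L j) = {}" if "i < M" "j < M" "i < j" for i j
  proof -
    have "Suc i * L \<le> j * L" using that by (intro mult_le_mono1) simp
    then have "{i * L..<Suc i * L} \<inter> {j * L..<Suc j * L} = {}" by auto
    moreover have "{i * L..<Suc i * L} \<union> {j * L..<Suc j * L} \<subseteq> {..<length p}"
      using block_fits[OF that(1)] block_fits[OF that(2)] by (intro Un_least subsetI) simp_all
    moreover have "inj_on ((!) p) {..<length p}" using p by (simp add: inj_on_nth)
    ultimately show ?thesis
      unfolding set_block[OF that(1)] set_block[OF that(2)]
      by (metis Un_subset_iff image_empty inj_on_image_Int)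
  qed
  show ?thesis using *[of i j] *[of j i] assms by (metis Int_commute linorder_neqE_nat)
qed

text \<open>The blocks have disjoint edge sets, so each missing edge spoils at most one of them.\<close>
lemma unbroken_blocks:
  "M - card (edges p - edges q) \<le> card {i. i < M \<and> edges (block p L i) \<subseteq> edges q}"
proof -
  define Bad where "Bad = {i. i < M \<and> \<not> edges (block p L i) \<subseteq> edges q}"
  define g where "g i = (SOME f. f \<in> edges (block p L i) - edges q)" for i
  have g: "g i \<in> edges (block p L i) - edges q" if "i \<in> Bad" for i
    unfolding g_def by (rule someI_ex) (use that in \<open>auto simp: Bad_def\<close>)
  have "inj_on g Bad"
  proof (rule inj_onI, rule ccontr)
    fix i j assume ij: "i \<in> Bad" "j \<in> Bad" "g i = g j" "i \<noteq> j"
    have "g i \<in> edges (block p L i)" "g i \<in> edges (block p L j)"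
      using g[OF ij(1)] g[OF ij(2)] ij(3) by auto
    then have "g i \<subseteq> set (block p L i)" "g i \<subseteq> set (block p L j)" "g i \<noteq> {}"
      by (auto dest: edges_subset_set edge_nonempty)
    then show False using blocks_disjoint[of i j] ij by (auto simp: Bad_def)
  qed
  moreover have "g ` Bad \<subseteq> edges p - edges q" using g edges_block_subset by blast
  ultimately have "card Bad \<le> card (edges p - edges q)" by (metis card_inj_on_le finite_Diff finite_edges)
  have eq: "{i. i < M \<and> edges (block p L i) \<subseteq> edges q} = {..<M} - Bad" by (auto simp: Bad_def)
  have "Bad \<subseteq> {..<M}" by (auto simp: Bad_def)
  then have "card ({..<M} - Bad) = M - card Bad" by (simp add: card_Diff_subset finite_subset)
  with \<open>card Bad \<le> card (edges p - edges q)\<close> show ?thesis unfolding eq by linarith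
qed

end

section \<open>Local rotations\<close>

definition nbrs_in :: "'a set set \<Rightarrow> 'a \<Rightarrow> 'a set" where
  "nbrs_in H w = {y. {w, y} \<in> H}"

lemma nbrs_in_sym: "y \<in> nbrs_in H w \<longleftrightarrow> w \<in> nbrs_in H y"
  by (simp add: nbrs_in_def insert_commute)

lemma nbrs_in_path:
  assumes "distinct p" "H \<subseteq> edges p"
  shows "finite (nbrs_in H w)" "card (nbrs_in H w) \<le> 2"
proof -
  have sub: "nbrs_in H w \<subseteq> {y. {w, y} \<in> edges p}" using assms by (auto simp: nbrs_in_def)
  show "finite (nbrs_in H w)" using finite_subset[OF sub path_nbrs(1)[OF assms(1)]] .
  show "card (nbrs_in H w) \<le> 2"
    using card_mono[OF path_nbrs(1)[OF assms(1)] sub] path_nbrs(2)[OF assms(1), of w] by linarith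
qed

context edge_graph
begin

text \<open>The edge set \<open>H\<close> consists of pieces of a path that are to be kept under control.  A pivot is an inner
  vertex of such a piece both of whose path neighbours lie in \<open>Y\<close>, so that rotating there creates
  an endpoint in \<open>Y\<close>.\<close>
definition pivots :: "'a set set \<Rightarrow> 'a set \<Rightarrow> 'a set" where
  "pivots H Y = {w. w \<noteq> u \<and> w \<noteq> v \<and> nbrs_in H w \<subseteq> Y \<and> (\<exists>y1\<in>nbrs_in H w. \<exists>y2\<in>nbrs_in H w. y1 \<noteq> y2)}"

inductive rotates :: "'a set set \<Rightarrow> 'a set \<Rightarrow> 'a list \<Rightarrow> 'a list \<Rightarrow> bool" for H Y p where
  base: "rotates H Y p p"
| rot: "rotates H Y p (xs @ w # y # ys) \<Longrightarrow> {last (y # ys), w} \<in> X \<Longrightarrow> w \<in> pivots H Y \<Longrightarrow> {w, y} \<in> H \<Longrightarrow>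
    rotates H Y p (xs @ w # rev (y # ys))"

definition local_ends :: "'a set set \<Rightarrow> 'a set \<Rightarrow> 'a list \<Rightarrow> 'a set" where
  "local_ends H Y p = {y \<in> Y. \<exists>p'. rotates H Y p p' \<and> last p' = y}"

lemma pivot_ends: "w \<in> pivots H Y \<Longrightarrow> {w, y} \<in> H \<Longrightarrow> y \<in> Y"
  by (auto simp: pivots_def nbrs_in_def)

lemma rotates_reroute:
  assumes "rotates H Y p p'" "distinct p"
  shows "reroute p p'"
  using assms
proof (induction rule: rotates.induct)
  case base
  then show ?case by (rule reroute_refl)
next
  case (rot xs w y ys)
  then have R: "reroute p (xs @ w # y # ys)" by simp
  then have "distinct (xs @ w # y # ys)" by (simp add: reroute_def)
  then show ?case using reroute_trans[OF R] rotate(1)[OF _ refl, of xs w y ys] rot.hyps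
    by (auto simp: pivots_def)
qed

text \<open>Only edges of \<open>H\<close> are broken, and each of them when one of its vertices becomes an endpoint.\<close>
lemma rotates_broken:
  assumes "rotates H Y p p'" "distinct p" "H \<subseteq> edges p" "f \<in> H - edges p'"
  shows "f \<inter> local_ends H Y p \<noteq> {}"
  using assms
proof (induction rule: rotates.induct)
  case (rot xs w y ys)
  have "reroute p (xs @ w # y # ys)" using rotates_reroute rot by blast
  then have d: "distinct (xs @ w # y # ys)" by (simp add: reroute_def)
  have "edges (xs @ w # y # ys) \<subseteq> insert {w, y} (edges (xs @ w # rev (y # ys)))"
    by (rule rotate(3)[OF d refl]) (use rot.hyps in \<open>auto simp: pivots_def\<close>)
  moreover have "y \<in> local_ends H Y p"
  proof -
    have "rotates H Y p (xs @ w # rev (y # ys))" by (rule rotates.rot[OF rot.hyps])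
    moreover have "last (xs @ w # rev (y # ys)) = y" by simp
    ultimately show ?thesis using pivot_ends[OF rot.hyps(3,4)] unfolding local_ends_def by blast
  qed
  ultimately show ?case using rot by blast
qed auto

lemma new_end:
  assumes p: "distinct p" and r: "rotates H Y p p'" and w: "w \<in> pivots H Y" "{last p', w} \<in> X"
    and intact: "\<And>y. y \<in> nbrs_in H w \<Longrightarrow> {w, y} \<in> edges p'"
  shows "nbrs_in H w \<inter> local_ends H Y p \<noteq> {}"
proof -
  have d: "distinct p'" using rotates_reroute[OF r p] by (simp add: reroute_def)
  obtain y1 y2 where y: "y1 \<in> nbrs_in H w" "y2 \<in> nbrs_in H w" "y1 \<noteq> y2" using w by (auto simp: pivots_def)
  have "w \<noteq> last p'" using edge_ends[OF w(2)] by auto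
  then obtain xs z ys where z: "p' = xs @ w # z # ys" "z = y1 \<or> z = y2"
    using successor_among_neighbours[OF d intact[OF y(1)] intact[OF y(2)] y(3)] by blast
  have zH: "z \<in> nbrs_in H w" "{w, z} \<in> H" using y z by (auto simp: nbrs_in_def)
  have "rotates H Y p (xs @ w # rev (z # ys))"
    by (rule rotates.rot) (use r z w zH in auto)
  moreover have "last (xs @ w # rev (z # ys)) = z" by simp
  ultimately have "z \<in> local_ends H Y p" using pivot_ends[OF w(1) zH(2)] unfolding local_ends_def by blast
  then show ?thesis using zH by auto
qed

text \<open>Posa's argument confined to the pivots: a neighbour \<open>w\<close> of the endpoint set \<open>S\<close> that is a pivot
  has an \<open>H\<close>-neighbour in \<open>S\<close>, for otherwise its \<open>H\<close>-edges are all intact and rotating at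
  \<open>w\<close> puts an \<open>H\<close>-neighbour into \<open>S\<close>.  Hence \<open>S\<close> has at most \<open>2 |S|\<close> neighbours among the
  pivots, and the expansion assumption forces it to be large.\<close>
lemma local_posa:
  assumes p: "distinct p" and H: "H \<subseteq> edges p" and Y: "finite Y"
    and exp: "\<And>S. S \<subseteq> Y \<Longrightarrow> S \<noteq> {} \<Longrightarrow> card S \<le> M \<Longrightarrow> 2 * card S < card (nbh S \<inter> pivots H Y)"
    and start: "{last p, w} \<in> X" "w \<in> pivots H Y"
  obtains S where "M < card S" "\<And>y. y \<in> S \<Longrightarrow> \<exists>p'. reroute p p' \<and> last p' = y"
proof -
  let ?S = "local_ends H Y p"
  have fS: "finite ?S" using Y by (simp add: local_ends_def)
  have nbrs_in: "finite (nbrs_in H y)" "card (nbrs_in H y) \<le> 2" for y using nbrs_in_path[OF p H] by auto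
  have "nbrs_in H w \<inter> ?S \<noteq> {}"
    by (rule new_end[OF p rotates.base start(2) start(1)]) (use H in \<open>auto simp: nbrs_in_def\<close>)
  then have ne: "?S \<noteq> {}" by auto
  have sub: "nbh ?S \<inter> pivots H Y \<subseteq> (\<Union>y\<in>?S. nbrs_in H y)"
  proof
    fix z assume z: "z \<in> nbh ?S \<inter> pivots H Y"
    then obtain p' where p': "rotates H Y p p'" "{last p', z} \<in> X" "z \<notin> ?S"
      by (auto simp: nbh_def local_ends_def)
    have "nbrs_in H z \<inter> ?S \<noteq> {}"
    proof (rule ccontr)
      assume no: "\<not> nbrs_in H z \<inter> ?S \<noteq> {}"
      then have "{z, y} \<inter> ?S = {}" if "y \<in> nbrs_in H z" for y using that p'(3) by auto
      then have "{z, y} \<in> edges p'" if "y \<in> nbrs_in H z" for y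
        using rotates_broken[OF p'(1) p H, of "{z, y}"] that by (auto simp: nbrs_in_def)
      then show False using new_end[OF p p'(1) _ p'(2)] z no by blast
    qed
    then obtain y where "y \<in> ?S" "y \<in> nbrs_in H z" by blast
    then show "z \<in> (\<Union>y\<in>?S. nbrs_in H y)" using nbrs_in_sym[of y H z] by blast
  qed
  have "card (nbh ?S \<inter> pivots H Y) \<le> 2 * card ?S"
    by (rule card_nbhd_le_double[OF fS, of "nbrs_in H"]) (use nbrs_in sub in auto)
  then have "M < card ?S" using exp[of ?S] ne by (force simp: local_ends_def)
  moreover have "\<exists>p'. reroute p p' \<and> last p' = y" if "y \<in> ?S" for y
    using that rotates_reroute[OF _ p] by (auto simp: local_ends_def)
  ultimately show ?thesis using that by blast
qed

text \<open>An inner vertex of a piece has two neighbours within the piece, so only \<open>u\<close>, \<open>v\<close> and the two ends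
  of each piece are lost.\<close>
lemma pivots_of_blocks:
  fixes seg :: "'b \<Rightarrow> 'a list"
  assumes I: "finite I" and L: "\<And>i. i \<in> I \<Longrightarrow> distinct (seg i) \<and> length (seg i) = L"
    and disj: "\<And>i j. i \<in> I \<Longrightarrow> j \<in> I \<Longrightarrow> i \<noteq> j \<Longrightarrow> set (seg i) \<inter> set (seg j) = {}"
    and fin: "finite (pivots (\<Union>i\<in>I. edges (seg i)) (\<Union>i\<in>I. set (seg i)))"
  shows "card I * L \<le> card (pivots (\<Union>i\<in>I. edges (seg i)) (\<Union>i\<in>I. set (seg i))) + 2 * card I + 2"
proof -
  let ?H = "\<Union>i\<in>I. edges (seg i)" and ?C = "\<Union>i\<in>I. set (seg i)"
  let ?E = "\<Union>i\<in>I. {hd (seg i), last (seg i)}"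
  have sub: "?C \<subseteq> pivots ?H ?C \<union> (?E \<union> {u, v})"
  proof
    fix w assume "w \<in> ?C"
    then obtain i where i: "i \<in> I" "w \<in> set (seg i)" by auto
    have H: "nbrs_in ?H w \<subseteq> ?C" by (auto simp: nbrs_in_def dest!: edges_subset_set)
    show "w \<in> pivots ?H ?C \<union> (?E \<union> {u, v})"
    proof (cases "w \<in> ?E \<union> {u, v}")
      case False
      then have w: "w \<noteq> hd (seg i)" "w \<noteq> last (seg i)" "w \<noteq> u" "w \<noteq> v" using i by auto
      obtain y1 y2 where "y1 \<noteq> y2" "{w, y1} \<in> edges (seg i)" "{w, y2} \<in> edges (seg i)"
        using inner_vertex_two_nbrs[of "seg i" w] L[OF i(1)] i w by blast
      then show ?thesis using w H i unfolding pivots_def nbrs_in_def by blast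
    qed auto
  qed
  have "card I * L = card ?C"
    using card_UN_disjoint[of I "\<lambda>i. set (seg i)"] I L disj by (simp add: distinct_card)
  also have "\<dots> \<le> card (pivots ?H ?C \<union> (?E \<union> {u, v}))"
    by (rule card_mono[OF _ sub]) (use fin I in auto)
  also have "\<dots> \<le> card (pivots ?H ?C) + (card ?E + card {u, v})"
    by (meson add_mono card_Un_le le_refl order_trans)
  also have "card ?E \<le> 2 * card I"
    by (rule card_nbhd_le_double[OF I, of "\<lambda>i. {hd (seg i), last (seg i)}"]) (auto simp: card_insert_if)
  also have "card {u, v} \<le> 2" by (simp add: card_insert_if)
  finally show ?thesis by simp
qed

text \<open>A path with adjacent ends closes to a cycle.  If the cycle missed a vertex, some edge would leave
  it at a vertex \<open>w\<close>; opening the cycle at an edge at \<open>w\<close> other than \<open>uv\<close> and appending the edge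
  would give a longer path.  So the cycle is Hamiltonian, and deleting \<open>uv\<close> from it leaves a path
  from \<open>u\<close> to \<open>v\<close>.\<close>
lemma close_longest_uv_path:
  assumes p: "longest_uv_path p" and c: "{hd p, last p} \<in> X"
    and conn: "set p \<noteq> V \<Longrightarrow> \<exists>z\<in>V - set p. \<exists>w\<in>set p. {z, w} \<in> X"
  obtains q where "distinct q" "set q = V" "edges q \<subseteq> X" "hd q = u" "last q = v"
proof -
  have P: "distinct p" "set p \<subseteq> V" "edges p \<subseteq> insert {u, v} X" "{u, v} \<in> edges p"
    using p by (auto simp: longest_uv_path_def uv_path_def)
  have V: "set p = V"
  proof (rule ccontr)
    assume "set p \<noteq> V"
    then obtain z w where z: "z \<in> V" "z \<notin> set p" "w \<in> set p" "{z, w} \<in> X" using conn by blast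
    then obtain xs ys where s: "p = xs @ w # ys" by (meson split_list)
    have long: "\<not> uv_path q" if "length q = Suc (length p)" for q
      using p that unfolding longest_uv_path_def by (metis Suc_n_not_le_n)
    show False
    proof (cases "xs \<noteq> [] \<and> {u, v} = {last xs, w}")
      case True
      \<comment> \<open>the edge before \<open>w\<close> is \<open>uv\<close>, so open the cycle after \<open>w\<close>\<close>
      let ?q = "z # rev (xs @ [w]) @ rev ys"
      have e1: "edges p = edges (xs @ [w]) \<union> (if ys = [] then {} else insert {w, hd ys} (edges ys))"
        using edges_append[of "xs @ [w]" ys] s by auto
      have "edges (rev (xs @ [w]) @ rev ys) =
          edges (xs @ [w]) \<union> (if ys = [] then {} else insert {hd (xs @ [w]), last ys} (edges ys))"
        using edges_append[of "rev (xs @ [w])" "rev ys"] edges_rev[of "xs @ [w]"] edges_rev[of ys]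
        by (auto simp: last_rev hd_rev simp del: edges_rev rev_append)
      then have e2: "edges ?q = insert {z, w} (edges (xs @ [w]) \<union>
          (if ys = [] then {} else insert {hd p, last p} (edges ys)))"
        using s True by (subst edges_Cons) (auto simp: hd_append)
      have "{u, v} \<in> edges (xs @ [w])" using True by (simp add: edges_append)
      then have "uv_path ?q" unfolding uv_path_def e2 using P s z c e1 by auto
      then show False using long[of ?q] s by simp
    next
      case False
      let ?q = "z # (w # ys) @ xs"
      have e1: "edges p = edges (w # ys) \<union> (if xs = [] then {} else insert {last xs, w} (edges xs))"
        using edges_append[of xs "w # ys"] s by auto
      have "edges ((w # ys) @ xs) =
          edges (w # ys) \<union> (if xs = [] then {} else insert {last p, hd p} (edges xs))"
        using edges_append[of "w # ys" xs] s by auto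
      then have e2: "edges ?q = insert {z, w} (edges (w # ys) \<union>
          (if xs = [] then {} else insert {last p, hd p} (edges xs)))"
        by (subst edges_Cons) auto
      have "{last p, hd p} \<in> X" using c by (simp add: insert_commute)
      then have "uv_path ?q" unfolding uv_path_def e2 using P s z False unfolding e1
        by (auto split: if_splits)
      then show False using long[of ?q] s by simp
    qed
  qed
  obtain xs a b ys where s: "p = xs @ a # b # ys" "{u, v} = {a, b}" using edge_split[OF P(4)] .
  let ?q = "(b # ys) @ (xs @ [a])"
  have d: "distinct ?q" "set ?q = V" using P V s by auto
  have "edges p = insert {a, b} (edges (xs @ [a]) \<union> edges (b # ys))"
    using edges_append[of "xs @ [a]" "b # ys"] s by simp
  moreover have "b \<notin> set (xs @ [a])" "a \<notin> set (b # ys)" using P(1) s(1) by auto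
  then have "{a, b} \<notin> edges (xs @ [a])" "{a, b} \<notin> edges (b # ys)"
    using edges_subset_set[of "{a, b}" "xs @ [a]"] edges_subset_set[of "{a, b}" "b # ys"] by auto
  moreover have "edges ?q = insert {last p, hd p} (edges (b # ys) \<union> edges (xs @ [a]))"
    using edges_append[of "b # ys" "xs @ [a]"] s by (auto simp: hd_append)
  ultimately have E: "edges ?q \<subseteq> X" using P s c by (auto simp: insert_commute)
  have "a = u \<and> b = v \<or> a = v \<and> b = u" using s by (auto simp: doubleton_eq_iff)
  then show ?thesis
  proof
    assume "a = u \<and> b = v"
    then have "hd (rev ?q) = u" "last (rev ?q) = v" by simp_all
    moreover have "distinct (rev ?q)" "set (rev ?q) = V" "edges (rev ?q) \<subseteq> X"
      using d E by (simp_all only: distinct_rev set_rev edges_rev)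
    ultimately show ?thesis using that by blast
  next
    assume "a = v \<and> b = u"
    then show ?thesis using that[of ?q] d E by simp
  qed
qed

end

context expander
begin

lemma few_without_neighbour:
  assumes "W \<subseteq> V" "2 * m \<le> card W"
  shows "card {b \<in> V. \<forall>w\<in>W. {b, w} \<notin> X} < 2 * m"
proof (rule ccontr)
  assume "\<not> ?thesis"
  then have "m \<le> card {b \<in> V. \<forall>w\<in>W. {b, w} \<notin> X}" by simp
  then obtain B where B: "B \<subseteq> {b \<in> V. \<forall>w\<in>W. {b, w} \<notin> X}" "card B = m" "finite B"
    by (rule obtain_subset_with_card_n)
  have "m \<le> card (W - B)" using assms B diff_card_le_card_Diff[OF B(3), of W] by linarith
  then obtain b w where "b \<in> B" "w \<in> W - B" "{b, w} \<in> X" 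
    using joined[of B "W - B"] B assms by blast
  then show False using B by auto
qed

text \<open>If \<open>Z\<close> has at least \<open>m\<close> vertices, joinedness applies; a smaller set contains a subset of size at most
  \<open>k\<close> whose neighbourhood is nonempty or too large to stay inside.\<close>
lemma leaves_set:
  assumes Z: "Z \<subseteq> V" "Z \<noteq> {}" "m \<le> card (V - Z)"
  shows "\<exists>z\<in>Z. \<exists>w\<in>V - Z. {z, w} \<in> X"
proof (cases "m \<le> card Z")
  case True
  then show ?thesis using joined[of Z "V - Z"] Z by auto
next
  case False
  obtain Z' where Z': "Z' \<subseteq> Z" "card Z' = min k (card Z)" "finite Z'"
    by (meson min.cobounded2 obtain_subset_with_card_n)
  have nb: "4 * D * card Z' \<le> card (nbh Z')" using expand[of Z'] Z Z' by auto
  have fZ: "finite Z" using Z finite_sub by blast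
  have Z0: "0 < card Z" using fZ Z(2) by (simp add: card_gt_0_iff)
  have "\<not> nbh Z' \<subseteq> Z"
  proof (cases "card Z \<le> k")
    case True
    then have "Z' = Z" using Z' fZ by (simp add: card_subset_eq)
    moreover have "nbh Z \<noteq> {}" using nb Z0 D \<open>Z' = Z\<close> by auto
    ultimately show ?thesis by (auto simp: nbh_def)
  next
    case False
    then have "card Z < card (nbh Z')" using nb Z'(2) Dk \<open>\<not> m \<le> card Z\<close> by simp
    then show ?thesis using fZ card_mono not_le by blast
  qed
  then show ?thesis using Z' by (auto simp: nbh_def)
qed

text \<open>Delete from \<open>C\<close> a largest set \<open>Z\<close> of size at most \<open>2 m\<close> that fails to expand into the
  remaining pivots.  If \<open>Z\<close> had between \<open>m\<close> and \<open>2 m\<close> elements, joinedness would leave fewer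
  than \<open>m + 3 |Z|\<close> pivots, and at most \<open>2 |Z|\<close> are lost with \<open>Z\<close>, which makes fewer than \<open>11 m\<close>.  So
  \<open>Z\<close> has fewer than \<open>m\<close> elements, and a further set of size at most \<open>m\<close> that fails to expand
  could be added to it.\<close>
lemma expanding_core:
  assumes H: "H \<subseteq> edges p" "distinct p" "set p \<subseteq> V" and C: "C \<subseteq> V"
    and large: "11 * m \<le> card (pivots H C)"
  obtains Y where "Y \<subseteq> C" "2 * m \<le> card (pivots H Y)" "pivots H Y \<subseteq> V"
    "\<And>S. S \<subseteq> Y \<Longrightarrow> S \<noteq> {} \<Longrightarrow> card S \<le> m \<Longrightarrow> 2 * card S < card (nbh S \<inter> pivots H Y)"
proof -
  have nbrs_in: "finite (nbrs_in H w)" "card (nbrs_in H w) \<le> 2" for w using nbrs_in_path[OF H(2,1)] by auto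
  have pV: "pivots H Y \<subseteq> V" for Y
  proof
    fix w assume "w \<in> pivots H Y"
    then obtain y where "{w, y} \<in> edges p" using H by (auto simp: pivots_def nbrs_in_def)
    then show "w \<in> V" using edges_subset_set H by fastforce
  qed
  have fC: "finite C" using C by (rule finite_sub)
  define bad where "bad Z \<longleftrightarrow> Z \<subseteq> C \<and> card Z \<le> 2 * m \<and> card (nbh Z \<inter> pivots H (C - Z)) \<le> 2 * card Z" for Z
  have "bad {}" by (auto simp: bad_def nbh_def)
  then obtain Z where Z: "bad Z" "\<And>Z'. bad Z' \<Longrightarrow> card Z' \<le> card Z"
    using ex_has_greatest_nat[of bad "{}" card "Suc (2 * m)"] unfolding bad_def
    by (metis le_imp_less_Suc)
  have fZ: "finite Z" "Z \<subseteq> V" using Z fC C finite_subset by (auto simp: bad_def)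
  let ?W = "pivots H (C - Z)"
  have fW: "finite ?W" using pV by (rule finite_sub)
  have "pivots H C \<subseteq> ?W \<union> (\<Union>z\<in>Z. nbrs_in H z)"
  proof
    fix w assume w: "w \<in> pivots H C"
    show "w \<in> ?W \<union> (\<Union>z\<in>Z. nbrs_in H z)"
    proof (cases "nbrs_in H w \<inter> Z = {}")
      case True
      then show ?thesis using w by (auto simp: pivots_def)
    next
      case False
      then obtain z where "z \<in> Z" "z \<in> nbrs_in H w" by blast
      then show ?thesis using nbrs_in_sym[of z H w] by blast
    qed
  qed
  then have "card (pivots H C) \<le> card (?W \<union> (\<Union>z\<in>Z. nbrs_in H z))"
    using fW fZ nbrs_in by (intro card_mono) auto
  also have "\<dots> \<le> card ?W + card (\<Union>z\<in>Z. nbrs_in H z)" by (rule card_Un_le)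
  also have "card (\<Union>z\<in>Z. nbrs_in H z) \<le> 2 * card Z"
    by (rule card_nbhd_le_double[OF fZ(1), of "nbrs_in H"]) (use nbrs_in in auto)
  finally have W: "11 * m \<le> card ?W + 2 * card Z" using large by linarith
  have Zm: "card Z < m"
  proof (rule ccontr)
    assume "\<not> ?thesis"
    then have nn: "card ((?W - Z) - nbh Z) < m" using nonneighbours_few[of Z "?W - Z"] fZ pV by auto
    have "?W \<subseteq> Z \<union> ((nbh Z \<inter> ?W) \<union> ((?W - Z) - nbh Z))" by auto
    then have "card ?W \<le> card (Z \<union> ((nbh Z \<inter> ?W) \<union> ((?W - Z) - nbh Z)))"
      using fZ fW by (intro card_mono) auto
    also have "\<dots> \<le> card Z + (card (nbh Z \<inter> ?W) + card ((?W - Z) - nbh Z))"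
      by (meson add_mono card_Un_le le_refl order_trans)
    finally show False using W nn Z(1) unfolding bad_def by linarith
  qed
  show ?thesis
  proof (rule that[of "C - Z"])
    show "2 * m \<le> card ?W" using W Zm by linarith
    fix S assume S: "S \<subseteq> C - Z" "S \<noteq> {}" "card S \<le> m"
    have fS: "finite S" using S fC finite_subset by blast
    show "2 * card S < card (nbh S \<inter> ?W)"
    proof (rule ccontr)
      assume c: "\<not> ?thesis"
      have cZS: "card (Z \<union> S) = card Z + card S" using S fZ fS by (subst card_Un_disjoint) auto
      have "nbh (Z \<union> S) \<inter> pivots H (C - (Z \<union> S)) \<subseteq> (nbh Z \<inter> ?W) \<union> (nbh S \<inter> ?W)"
        by (auto simp: nbh_def pivots_def)
      then have "card (nbh (Z \<union> S) \<inter> pivots H (C - (Z \<union> S))) \<le> card ((nbh Z \<inter> ?W) \<union> (nbh S \<inter> ?W))"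
        using fW by (intro card_mono) auto
      also have "\<dots> \<le> card (nbh Z \<inter> ?W) + card (nbh S \<inter> ?W)" by (rule card_Un_le)
      also have "\<dots> \<le> 2 * card (Z \<union> S)" using c Z(1) cZS by (simp add: bad_def)
      finally have "bad (Z \<union> S)" using Z(1) S cZS Zm by (auto simp: bad_def)
      then have "card S = 0" using Z(2) cZS by fastforce
      then show False using S fS by simp
    qed
  qed (use pV in auto)
qed

end

section \<open>Closing a longest path\<close>

text \<open>\<open>T\<close> bounds the number of rotations for one end, and \<open>l\<close> is the number of blocks in each of the two
  families.  The last three conditions are the competing demands on \<open>l\<close>: it is small compared
  with the number of blocks, \<open>l\<close> blocks have room for \<open>11 m\<close> pivots, and the loss \<open>64\<^sup>l\<close> from fixing
  the families leaves more than \<open>4 m n\<close> pairs of ends.\<close>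
definition admissible :: "nat \<Rightarrow> nat \<Rightarrow> nat \<Rightarrow> nat \<Rightarrow> nat \<Rightarrow> nat \<Rightarrow> bool" where
  "admissible n D k m T l \<longleftrightarrow> 3 \<le> D \<and> 1 \<le> m \<and> 2 * m + 2 \<le> D * k \<and> 24 * k + 15 * m + 20 \<le> n \<and>
     k < D ^ (T - 2) \<and> 2 * l \<le> T \<and> 11 * m + 2 * l + 2 \<le> l * (n div 3 div (4 * T)) \<and>
     64 ^ l * (4 * m * n) < (n div 3)\<^sup>2"

context expander
begin

lemma longest_uv_path_exists: "\<exists>p. longest_uv_path p"
proof -
  show ?thesis
  proof (cases "\<exists>p. uv_path p")
    case True
    then obtain p0 where "uv_path p0" by blast
    moreover have "length p < Suc (card V)" if "uv_path p" for p
      using that finite_V by (metis card_mono distinct_card uv_path_def le_imp_less_Suc)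
    ultimately show ?thesis
      unfolding longest_uv_path_def using ex_has_greatest_nat[of uv_path p0 length "Suc (card V)"] by blast
  next
    case False
    have "uv_path [u, v]" using uv by (simp add: uv_path_def)
    with False show ?thesis by blast
  qed
qed

definition end_pairs :: "'a list \<Rightarrow> nat \<Rightarrow> ('a \<times> 'a) set" where
  "end_pairs p t = {(b, a) \<in> V \<times> V. \<exists>q. longest_uv_path q \<and> set q = set p \<and> hd q = b \<and> last q = a \<and>
     card (edges p - edges q) \<le> t}"

text \<open>Rotate one end with the other fixed, and then, for each endpoint obtained, rotate the opposite
  end.\<close>
lemma many_end_pairs:
  assumes p: "longest_uv_path p" and T: "k < D ^ (T - 2)"
  shows "(card V div 3)\<^sup>2 \<le> card (end_pairs p (2 * T))" "card V div 3 \<le> length p"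
proof -
  have d: "distinct p" "p \<noteq> []" using p by (auto simp: longest_uv_path_def uv_path_def)
  obtain B where B: "card B = card V div 3"
    and P: "\<And>b. b \<in> B \<Longrightarrow> \<exists>p'. reroute p p' \<and> last p' = b \<and> card (edges p - edges p') \<le> T"
    using many_endpoints[OF p T] by blast
  have BV: "B \<subseteq> set p" "B \<subseteq> V"
  proof -
    show "B \<subseteq> set p"
    proof
      fix b assume "b \<in> B"
      then obtain p' where "reroute p p'" "last p' = b" using P by blast
      then show "b \<in> set p" using d by (metis last_in_set reroute_def set_empty)
    qed
    then show "B \<subseteq> V" using p by (auto simp: longest_uv_path_def uv_path_def)
  qed
  show "card V div 3 \<le> length p"
    using card_mono[OF _ BV(1)] B d distinct_card by fastforce
  have "\<exists>A. card A = card V div 3 \<and> A \<subseteq> {a. (b, a) \<in> end_pairs p (2 * T)}" if b: "b \<in> B" for b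
  proof -
    obtain p' where p': "reroute p p'" "last p' = b" "card (edges p - edges p') \<le> T" using P[OF b] by blast
    have l: "longest_uv_path (rev p')" using longest_uv_path_rev longest_uv_path_reroute[OF p p'(1)] .
    obtain A where A: "card A = card V div 3"
      and Q: "\<And>a. a \<in> A \<Longrightarrow> \<exists>q. reroute (rev p') q \<and> last q = a \<and> card (edges (rev p') - edges q) \<le> T"
      using many_endpoints[OF l T] by blast
    have "(b, a) \<in> end_pairs p (2 * T)" if a: "a \<in> A" for a
    proof -
      obtain q where q: "reroute (rev p') q" "last q = a" "card (edges p' - edges q) \<le> T"
        using Q[OF a] by auto
      have lq: "longest_uv_path q" using longest_uv_path_reroute[OF l q(1)] .
      have "p' \<noteq> []" using p' d by (auto simp: reroute_def)
      then have hq: "hd q = b" "set q = set p" using p' q by (auto simp: reroute_def hd_rev)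
      have "card (edges p - edges q) \<le> card ((edges p - edges p') \<union> (edges p' - edges q))"
        by (intro card_mono) auto
      also have "\<dots> \<le> 2 * T" using card_Un_le[of "edges p - edges p'" "edges p' - edges q"] p' q by linarith
      finally have c: "card (edges p - edges q) \<le> 2 * T" .
      have "q \<noteq> []" "set q \<subseteq> V" using lq by (auto simp: longest_uv_path_def uv_path_def)
      then have "a \<in> V" using q by auto
      then show ?thesis unfolding end_pairs_def using lq hq q c BV b by blast
    qed
    then show ?thesis using A by blast
  qed
  then obtain A where A: "\<And>b. b \<in> B \<Longrightarrow> card (A b) = card V div 3"
    "\<And>b. b \<in> B \<Longrightarrow> A b \<subseteq> {a. (b, a) \<in> end_pairs p (2 * T)}" by metis
  have fin: "finite (end_pairs p (2 * T))"
    by (rule finite_subset[of _ "V \<times> V"]) (auto simp: end_pairs_def finite_V)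
  have "A b \<subseteq> V" if "b \<in> B" for b using A(2)[OF that] by (auto simp: end_pairs_def)
  then have "card (Sigma B A) = (\<Sum>b\<in>B. card (A b))"
    using BV finite_sub by (intro card_SigmaI) auto
  also have "\<dots> = (card V div 3)\<^sup>2" using A B by (simp add: power2_eq_square)
  finally have "(card V div 3)\<^sup>2 = card (Sigma B A)" by simp
  also have "\<dots> \<le> card (end_pairs p (2 * T))" using A(2) by (intro card_mono fin) auto
  finally show "(card V div 3)\<^sup>2 \<le> card (end_pairs p (2 * T))" .
qed

text \<open>The pivots of the two ends lie in disjoint halves of the path, so rotations at one end do not
  interfere with rotations at the other, and the resulting ends can be combined freely.  Both sets
  of ends have more than \<open>m\<close> elements, hence an edge joins them.\<close>
lemma join_both_ends:
  assumes long: "longest_uv_path (p1 @ p2)"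
    and H1: "H1 \<subseteq> edges p1" and Y1: "finite Y1"
    and exp1: "\<And>S. S \<subseteq> Y1 \<Longrightarrow> S \<noteq> {} \<Longrightarrow> card S \<le> m \<Longrightarrow> 2 * card S < card (nbh S \<inter> pivots H1 Y1)"
    and start1: "{hd (p1 @ p2), w1} \<in> X" "w1 \<in> pivots H1 Y1"
    and H2: "H2 \<subseteq> edges p2" and Y2: "finite Y2"
    and exp2: "\<And>S. S \<subseteq> Y2 \<Longrightarrow> S \<noteq> {} \<Longrightarrow> card S \<le> m \<Longrightarrow> 2 * card S < card (nbh S \<inter> pivots H2 Y2)"
    and start2: "{last (p1 @ p2), w2} \<in> X" "w2 \<in> pivots H2 Y2"
  obtains q where "longest_uv_path q" "set q = set (p1 @ p2)" "{hd q, last q} \<in> X"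
proof -
  have P: "distinct (p1 @ p2)" "set (p1 @ p2) \<subseteq> V" "edges (p1 @ p2) \<subseteq> insert {u, v} X" "{u, v} \<in> edges (p1 @ p2)"
    using long by (auto simp: longest_uv_path_def uv_path_def)
  have ne: "p1 \<noteq> []" "p2 \<noteq> []" using start1(2) start2(2) H1 H2 by (auto simp: pivots_def nbrs_in_def)
  have d: "distinct (rev p1)" "distinct p2" using P by auto
  have s1: "{last (rev p1), w1} \<in> X" using start1(1) ne by (simp add: last_rev)
  have s2: "{last p2, w2} \<in> X" using start2(1) ne by simp
  have H1': "H1 \<subseteq> edges (rev p1)" using H1 by simp
  obtain S1 where S1: "m < card S1" "\<And>y. y \<in> S1 \<Longrightarrow> \<exists>p'. reroute (rev p1) p' \<and> last p' = y"
    using local_posa[OF d(1) H1' Y1 exp1 s1 start1(2)] by blast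
  obtain S2 where S2: "m < card S2" "\<And>y. y \<in> S2 \<Longrightarrow> \<exists>p'. reroute p2 p' \<and> last p' = y"
    using local_posa[OF d(2) H2 Y2 exp2 s2 start2(2)] by blast
  have "S1 \<subseteq> set p1"
  proof
    fix y assume "y \<in> S1"
    then obtain p' where "reroute (rev p1) p'" "last p' = y" using S1 by blast
    then show "y \<in> set p1" using ne by (metis last_in_set reroute_def set_empty set_rev)
  qed
  moreover have "S2 \<subseteq> set p2"
  proof
    fix y assume "y \<in> S2"
    then obtain p' where "reroute p2 p'" "last p' = y" using S2 by blast
    then show "y \<in> set p2" using ne by (metis last_in_set reroute_def set_empty)
  qed
  ultimately have "S1 \<subseteq> V" "S2 \<subseteq> V" "S1 \<inter> S2 = {}" using P by auto
  then obtain y1 y2 where y: "y1 \<in> S1" "y2 \<in> S2" "{y1, y2} \<in> X"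
    using joined[of S1 S2] S1(1) S2(1) by auto
  obtain q1 where q1: "reroute (rev p1) q1" "last q1 = y1" using S1(2)[OF y(1)] by blast
  obtain q2 where q2: "reroute p2 q2" "last q2 = y2" using S2(2)[OF y(2)] by blast
  have ne': "q1 \<noteq> []" "q2 \<noteq> []" using q1 q2 ne by (auto simp: reroute_def)
  let ?q = "rev q1 @ q2"
  have h: "hd q1 = last p1" "hd q2 = hd p2" using q1 q2 ne by (auto simp: reroute_def hd_rev)
  have e: "edges ?q = insert {last p1, hd p2} (edges q1 \<union> edges q2)"
    using ne' h by (simp add: edges_append last_rev)
  have e': "edges (p1 @ p2) = insert {last p1, hd p2} (edges p1 \<union> edges p2)"
    using ne by (simp add: edges_append)
  have E: "edges q1 \<subseteq> edges p1 \<union> X" "{u, v} \<in> edges p1 \<longrightarrow> {u, v} \<in> edges q1"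
    "edges q2 \<subseteq> edges p2 \<union> X" "{u, v} \<in> edges p2 \<longrightarrow> {u, v} \<in> edges q2"
    and s: "distinct q1" "set q1 = set p1" "distinct q2" "set q2 = set p2"
    using q1(1) q2(1) unfolding reroute_def by simp_all
  have "uv_path ?q"
    unfolding uv_path_def
  proof (intro conjI)
    show "distinct ?q" "set ?q \<subseteq> V" using P(1,2) s by auto
    show "edges ?q \<subseteq> insert {u, v} X" using P(3) E(1,3) unfolding e e' by blast
    show "{u, v} \<in> edges ?q" using P(4) E(2,4) unfolding e e' by blast
  qed
  moreover have set: "set ?q = set (p1 @ p2)" using q1 q2 by (auto simp: reroute_def)
  then have "length ?q = length (p1 @ p2)"
    using \<open>uv_path ?q\<close> P(1) by (metis distinct_card uv_path_def)
  ultimately have "longest_uv_path ?q" using long by (simp add: longest_uv_path_def)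
  moreover have "{hd ?q, last ?q} \<in> X" using y q1 q2 ne' by (simp add: hd_rev)
  ultimately show ?thesis using that set by blast
qed

text \<open>The pairs of ends come with paths that keep at least half of the \<open>4 T\<close> blocks of \<open>p\<close>
  intact.  Averaging over pairs of \<open>l\<close>-tuples of blocks fixes two families of \<open>l\<close> blocks
  that lie unbroken on the two sides of a cut for at least a \<open>64\<^sup>-\<^sup>l\<close> fraction of all pairs of
  ends.  Fewer than \<open>2 m\<close> vertices have no neighbour among the pivots of the core of a family,
  so not all of these pairs of ends can be unsuitable for local rotations.\<close>
theorem hamilton_path_between:
  assumes "admissible (card V) D k m T l"
  obtains q where "distinct q" "set q = V" "edges q \<subseteq> X" "hd q = u" "last q = v"
proof -
  define L where "L = card V div 3 div (4 * T)"
  have T: "k < D ^ (T - 2)" and l: "2 * l \<le> T"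
    and blocks: "11 * m + 2 * l + 2 \<le> l * L"
    and pairs: "64 ^ l * (4 * m * card V) < (card V div 3)\<^sup>2"
    using assms by (auto simp: admissible_def L_def)
  obtain p where p: "longest_uv_path p" using longest_uv_path_exists by blast
  have P: "distinct p" "set p \<subseteq> V" using p by (auto simp: longest_uv_path_def uv_path_def)
  define R where "R = end_pairs p (2 * T)"
  have R: "(card V div 3)\<^sup>2 \<le> card R" "card V div 3 \<le> length p"
    using many_end_pairs[OF p T] by (auto simp: R_def)
  have fR: "finite R"
    by (rule finite_subset[of _ "V \<times> V"]) (auto simp: R_def end_pairs_def finite_V)
  have "4 * T * L \<le> card V div 3" unfolding L_def by simp
  then have fit: "4 * T * L \<le> length p" using R(2) by linarith
  note blocks_facts = distinct_block[OF P(1) fit] length_block[OF P(1) fit] blocks_disjoint[OF P(1) fit]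
  have "0 < l * L" using blocks by linarith
  then have L0: "0 < L" and l0: "0 < l" by auto
  define lists where "lists = {c :: nat list. set c \<subseteq> {..<4 * T} \<and> length c = l}"
  have lists: "finite lists" "card lists = (4 * T) ^ l"
    unfolding lists_def by (simp_all add: finite_lists_length_eq card_lists_length_eq)
  define inside where "inside c p' \<longleftrightarrow> distinct c \<and>
    (\<forall>i\<in>set c. edges (block p L i) \<subseteq> edges p' \<and> set (block p L i) \<subseteq> set p')" for c p'
  \<comment> \<open>the relation to average over: it is for such a pair of ends \<open>r\<close> and pair of families \<open>c\<close> that
    local rotations on the two sides of a cut are available\<close>
  define split where "split r c \<longleftrightarrow> (\<exists>p1 p2. longest_uv_path (p1 @ p2) \<and> set (p1 @ p2) = set p \<and> 
    hd (p1 @ p2) = fst r \<and> last (p1 @ p2) = snd r \<and> inside (fst c) p1 \<and> inside (snd c) p2)"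
    for r and c :: "nat list \<times> nat list"
  have many: "((T - l) ^ l)\<^sup>2 \<le> card {c \<in> lists \<times> lists. split r c}" if r: "r \<in> R" for r
  proof -
    obtain q where q: "longest_uv_path q" "set q = set p" "hd q = fst r" "last q = snd r"
      "card (edges p - edges q) \<le> 2 * T" using r by (auto simp: R_def end_pairs_def)
    have dq: "distinct q" using q by (simp add: longest_uv_path_def uv_path_def)
    define I where "I = {i. i < 4 * T \<and> edges (block p L i) \<subseteq> edges q}"
    have I: "finite I" "T + T \<le> card I"
      using unbroken_blocks[OF P(1) fit, of q] q(5) by (auto simp: I_def)
    have seg: "block p L i \<noteq> [] \<and> set (block p L i) \<subseteq> set q \<and> edges (block p L i) \<subseteq> edges q"
      if "i \<in> I" for i
      using that blocks_facts(2)[of i] L0 set_block_subset[OF P(1) fit] q(2) by (auto simp: I_def)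
    have disj: "set (block p L i) \<inter> set (block p L j) = {}" if "i \<in> I" "j \<in> I" "i \<noteq> j" for i j
      using that blocks_facts(3) by (auto simp: I_def)
    obtain p1 p2 where cut: "q = p1 @ p2" "T \<le> card {i \<in> I. set (block p L i) \<subseteq> set p1}"
      "T \<le> card {i \<in> I. set (block p L i) \<subseteq> set p2}"
      by (rule balanced_cut[of q I T T "block p L", OF dq I seg disj])
    define J where "J p' = {i \<in> I. set (block p L i) \<subseteq> set p'}" for p'
    \<comment> \<open>Distinct tuples within at least \<open>T\<close> good blocks number at least \<open>(T - l)\<^sup>l\<close>, which because of
      \<open>2 l \<le> T\<close> is at least an \<open>8\<^sup>-\<^sup>l\<close> fraction of all \<open>(4 T)\<^sup>l\<close> tuples; both sides together give \<open>64\<^sup>-\<^sup>l\<close>.\<close>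
    define K where "K p' = {c. length c = l \<and> distinct c \<and> set c \<subseteq> J p'}" for p'
    have K: "(T - l) ^ l \<le> card (K p')" if "T \<le> card (J p')" for p'
      unfolding K_def using that I(1) l by (intro many_distinct_lists) (auto simp: J_def)
    have KL: "K p' \<subseteq> lists" for p' by (auto simp: K_def lists_def J_def I_def)
    have in1: "inside c p1" if c: "c \<in> K p1" for c
      unfolding inside_def
    proof (intro conjI ballI)
      show "distinct c" using c by (simp add: K_def)
      fix i assume "i \<in> set c"
      then have i: "i \<in> I" "set (block p L i) \<subseteq> set p1" using c by (auto simp: K_def J_def)
      then show "set (block p L i) \<subseteq> set p1" by simp
      show "edges (block p L i) \<subseteq> edges p1"
      proof
        fix f assume f: "f \<in> edges (block p L i)"
        then have "f \<in> edges (p1 @ p2)" "f \<subseteq> set p1"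
          using seg[OF i(1)] i(2) edges_subset_set[OF f] cut(1) by auto
        then show "f \<in> edges p1" using edges_left_part[of p1 p2 f] dq cut(1) by simp
      qed
    qed
    have in2: "inside c p2" if c: "c \<in> K p2" for c
      unfolding inside_def
    proof (intro conjI ballI)
      show "distinct c" using c by (simp add: K_def)
      fix i assume "i \<in> set c"
      then have i: "i \<in> I" "set (block p L i) \<subseteq> set p2" using c by (auto simp: K_def J_def)
      then show "set (block p L i) \<subseteq> set p2" by simp
      show "edges (block p L i) \<subseteq> edges p2"
      proof
        fix f assume f: "f \<in> edges (block p L i)"
        then have "f \<in> edges (p1 @ p2)" "f \<subseteq> set p2"
          using seg[OF i(1)] i(2) edges_subset_set[OF f] cut(1) by auto
        then show "f \<in> edges p2" using edges_right_part[of p1 p2 f] dq cut(1) by simp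
      qed
    qed
    have "K p1 \<times> K p2 \<subseteq> {c \<in> lists \<times> lists. split r c}"
    proof
      fix c assume "c \<in> K p1 \<times> K p2"
      then have c: "fst c \<in> K p1" "snd c \<in> K p2" by auto
      have "split r c"
        unfolding split_def by (intro exI[of _ p1] exI[of _ p2]) (use q cut(1) in1[OF c(1)] in2[OF c(2)] in simp)
      then show "c \<in> {c \<in> lists \<times> lists. split r c}" using c KL by (auto simp: mem_Times_iff)
    qed
    then have "card (K p1 \<times> K p2) \<le> card {c \<in> lists \<times> lists. split r c}"
      using lists(1) by (intro card_mono) auto
    moreover have "((T - l) ^ l)\<^sup>2 \<le> card (K p1) * card (K p2)"
      unfolding power2_eq_square using K cut by (intro mult_mono) (auto simp: J_def)
    ultimately show ?thesis by (simp add: card_cartesian_product)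
  qed
  have few: "card (lists \<times> lists) * (4 * m * card V) < card R * ((T - l) ^ l)\<^sup>2"
  proof -
    have "0 < T - l" using l l0 by linarith
    have "4 * T \<le> 8 * (T - l)" using l by linarith
    then have "((4 * T) ^ l)\<^sup>2 \<le> ((8 * (T - l)) ^ l)\<^sup>2" by (intro power_mono) auto
    also have "\<dots> = 64 ^ l * ((T - l) ^ l)\<^sup>2"
    proof -
      have "64 ^ l = ((8 :: nat) ^ l)\<^sup>2" by (simp add: power2_eq_square flip: power_mult_distrib)
      then show ?thesis by (simp only: power_mult_distrib)
    qed
    finally have "card (lists \<times> lists) * (4 * m * card V) \<le> 64 ^ l * ((T - l) ^ l)\<^sup>2 * (4 * m * card V)"
      using lists(2) by (simp add: card_cartesian_product power2_eq_square)
    also have "\<dots> = 64 ^ l * (4 * m * card V) * ((T - l) ^ l)\<^sup>2" by simp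
    also have "\<dots> < card R * ((T - l) ^ l)\<^sup>2"
      using pairs R(1) \<open>0 < T - l\<close> by (intro mult_strict_right_mono) auto
    finally show ?thesis .
  qed
  obtain c where c: "c \<in> lists \<times> lists" "4 * m * card V < card {r \<in> R. split r c}"
    by (rule double_count[OF fR _ many few]) (use lists(1) in auto)
  define Cs where "Cs c = (\<Union>i\<in>set c. set (block p L i))" for c
  define Hs where "Hs c = (\<Union>i\<in>set c. edges (block p L i))" for c
  have HC: "Hs c \<subseteq> edges p" "Cs c \<subseteq> V" for c
    using edges_block_subset[OF P(1) fit] set_block_subset[OF P(1) fit] P(2) unfolding Hs_def Cs_def by blast+
  have core: "\<exists>Y. Y \<subseteq> V \<and> 2 * m \<le> card (pivots (Hs c) Y) \<and> pivots (Hs c) Y \<subseteq> V \<and>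
    (\<forall>S. S \<subseteq> Y \<longrightarrow> S \<noteq> {} \<longrightarrow> card S \<le> m \<longrightarrow> 2 * card S < card (nbh S \<inter> pivots (Hs c) Y))"
    if c: "c \<in> lists" "distinct c" for c
  proof -
    have fin: "finite (pivots (Hs c) (Cs c))"
    proof (rule finite_sub, rule subsetI)
      fix w assume "w \<in> pivots (Hs c) (Cs c)"
      then obtain y where "{w, y} \<in> edges p" using HC by (fastforce simp: pivots_def nbrs_in_def)
      then show "w \<in> V" using edges_subset_set P by fastforce
    qed
    have lt: "i < 4 * T" if "i \<in> set c" for i using that c by (auto simp: lists_def)
    have "card (set c) * L \<le> card (pivots (Hs c) (Cs c)) + 2 * card (set c) + 2"
      unfolding Hs_def Cs_def
      by (rule pivots_of_blocks)
         (use blocks_facts lt fin in \<open>simp_all add: Hs_def Cs_def\<close>)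
    then have "11 * m \<le> card (pivots (Hs c) (Cs c))"
      using blocks c distinct_card[of c] by (simp add: lists_def)
    then show ?thesis
      using expanding_core[OF HC(1) P(1,2) HC(2)] HC(2) by (metis subset_trans)
  qed
  have "{r \<in> R. split r c} \<noteq> {}" using c(2) by (metis card.empty not_less_zero)
  then have dc: "distinct (fst c)" "distinct (snd c)" by (auto simp: split_def inside_def)
  have cl: "fst c \<in> lists" "snd c \<in> lists" using c(1) by auto
  obtain Y1 where Y1: "Y1 \<subseteq> V" "2 * m \<le> card (pivots (Hs (fst c)) Y1)" "pivots (Hs (fst c)) Y1 \<subseteq> V"
    "\<And>S. S \<subseteq> Y1 \<Longrightarrow> S \<noteq> {} \<Longrightarrow> card S \<le> m \<Longrightarrow> 2 * card S < card (nbh S \<inter> pivots (Hs (fst c)) Y1)"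
    using core[OF cl(1) dc(1)] by blast
  obtain Y2 where Y2: "Y2 \<subseteq> V" "2 * m \<le> card (pivots (Hs (snd c)) Y2)" "pivots (Hs (snd c)) Y2 \<subseteq> V"
    "\<And>S. S \<subseteq> Y2 \<Longrightarrow> S \<noteq> {} \<Longrightarrow> card S \<le> m \<Longrightarrow> 2 * card S < card (nbh S \<inter> pivots (Hs (snd c)) Y2)"
    using core[OF cl(2) dc(2)] by blast
  \<comment> \<open>the vertices that cannot start a local rotation with a pivot in \<open>W\<close>\<close>
  define N where "N W = {b \<in> V. \<forall>w\<in>W. {b, w} \<notin> X}" for W
  have N: "card (N W) \<le> 2 * m" "finite (N W)" if "W \<subseteq> V" "2 * m \<le> card W" for W
    using few_without_neighbour[OF that] finite_V by (auto simp: N_def)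
  let ?N1 = "N (pivots (Hs (fst c)) Y1)" and ?N2 = "N (pivots (Hs (snd c)) Y2)"
  have "\<not> {r \<in> R. split r c} \<subseteq> ?N1 \<times> V \<union> V \<times> ?N2"
  proof
    assume "{r \<in> R. split r c} \<subseteq> ?N1 \<times> V \<union> V \<times> ?N2"
    then have "card {r \<in> R. split r c} \<le> card (?N1 \<times> V \<union> V \<times> ?N2)"
      using N(2)[OF Y1(3,2)] N(2)[OF Y2(3,2)] finite_V by (intro card_mono) auto
    also have "\<dots> \<le> card (?N1 \<times> V) + card (V \<times> ?N2)" by (rule card_Un_le)
    also have "\<dots> \<le> 2 * m * card V + card V * (2 * m)"
      using N(1)[OF Y1(3,2)] N(1)[OF Y2(3,2)] unfolding card_cartesian_product
      by (intro add_mono mult_mono) auto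
    finally show False using c(2) by simp
  qed
  then obtain r where r: "r \<in> R" "split r c" "r \<notin> ?N1 \<times> V \<union> V \<times> ?N2" by blast
  have "r \<in> V \<times> V" using r(1) by (auto simp: R_def end_pairs_def)
  then obtain w1 w2 where w1: "w1 \<in> pivots (Hs (fst c)) Y1" "{fst r, w1} \<in> X"
    and w2: "w2 \<in> pivots (Hs (snd c)) Y2" "{snd r, w2} \<in> X"
    using r(3) by (auto simp: N_def mem_Times_iff)
  obtain p1 p2 where pp: "longest_uv_path (p1 @ p2)" "set (p1 @ p2) = set p"
    "hd (p1 @ p2) = fst r" "last (p1 @ p2) = snd r" "inside (fst c) p1" "inside (snd c) p2"
    using r(2) unfolding split_def by blast
  have HH: "Hs (fst c) \<subseteq> edges p1" "Hs (snd c) \<subseteq> edges p2"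
    using pp(5,6) by (auto simp: inside_def Hs_def)
  obtain q where q: "longest_uv_path q" "set q = set (p1 @ p2)" "{hd q, last q} \<in> X"
    by (rule join_both_ends[OF pp(1) HH(1) finite_sub[OF Y1(1)] _ _ w1(1)
          HH(2) finite_sub[OF Y2(1)] _ _ w2(1)])
       (use Y1(4) Y2(4) w1(2) w2(2) pp(3,4) in simp_all)
  have big: "m \<le> card (set q)"
    using R(2) size q(2) pp(2) distinct_card[OF P(1)] by simp
  have "\<exists>z\<in>V - set q. \<exists>w\<in>set q. {z, w} \<in> X" if "set q \<noteq> V"
  proof -
    have sq: "set q \<subseteq> V" using q(2) pp(2) P by simp
    then have "V - (V - set q) = set q" by auto
    then show ?thesis using leaves_set[of "V - set q"] that sq big by auto
  qed
  then show ?thesis using close_longest_uv_path[OF q(1) q(3)] that by metis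
qed

end

section \<open>Choice of the parameters\<close>

lemma ln_12_ge_2: "2 \<le> ln (12::real)"
proof -
  have "exp (2::real) = exp 1 * exp 1" by (simp flip: exp_add)
  also have "\<dots> \<le> 3 * 3" using exp_le by (intro mult_mono) auto
  finally show ?thesis by (simp add: ln_ge_iff)
qed

lemma real_div_minus_one_le: "real a / real b - 1 \<le> real (a div b)"
proof -
  have "real_of_int \<lfloor>real a / real b\<rfloor> = real (a div b)" by (simp add: floor_divide_of_nat_eq)
  then show ?thesis by linarith
qed

text \<open>With \<open>x\<close>, \<open>y\<close>, \<open>z\<close> the first three iterated logarithms of \<open>n\<close> and \<open>c\<close> an upper bound for \<open>ln d\<close>,
  the sizes \<open>\<beta> / d\<close> and \<open>\<beta> / 4130\<close> of the two hypotheses on the graph are rounded to \<open>k\<close> and \<open>m\<close>,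
  and \<open>D\<close> is \<open>d / 4\<close> rounded down.  As \<open>D\<^sup>3 \<ge> d\<close>, about \<open>T = 3 x / ln d\<close> rounds reach
  \<open>n\<close> vertices.  A block then has \<open>n / (12 T) \<ge> n ln d / (48 x)\<close> vertices, roughly, and
  \<open>l = y / z\<close> blocks have \<open>\<beta> / 48\<close>, more than \<open>11 \<beta> / 4130\<close>.  The assumptions \<open>e1\<close> to \<open>e7\<close>
  relate functions of \<open>n\<close> alone and absorb the rounding errors.\<close>
lemma rounded_parameters:
  fixes N d :: real and x y z c \<beta> :: real
  assumes "1 \<le> x" "1 \<le> y" "1 \<le> z" "x = ln N" "N = real n" "100 \<le> n"
    and d: "12 \<le> d" "d \<le> exp c" and c: "0 < c"
  defines "\<beta> \<equiv> N * y * ln d / (x * z)"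
  assumes e1: "2 * exp c + 40 \<le> N * y * 2 / (x * z)"
    and e2: "N * y * c / (x * z) \<le> N / 4"
    and e3: "2 * (y / z + 1) \<le> 3 * x / c"
    and e4: "3 \<le> x / c"
    and e5: "3 \<le> N * 2 / (48 * x)"
    and e6: "13 + 3 * (y / z) \<le> 18 / 1000 * (N * y * 2 / (x * z))"
    and e7: "64 powr (y / z + 1) * (4 * (N * y * c / (x * z))) < N / 16"
  obtains D k m T l :: nat where
    "admissible n D k m T l" "4 * real D \<le> d" "real k \<le> \<beta> / d" "\<beta> / 4130 \<le> real m"
proof -
  define D where "D = nat \<lfloor>d / 4\<rfloor>"
  define k where "k = nat \<lfloor>\<beta> / d\<rfloor>"
  define m where "m = nat \<lceil>\<beta> / 4130\<rceil>"
  define T where "T = nat \<lceil>3 * x / ln d\<rceil> + 2"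
  define l where "l = nat \<lceil>y / z\<rceil>"
  have N: "100 \<le> N" using assms by simp
  have ld: "2 \<le> ln d" using ln_12_ge_2 d by (meson ln_mono order_trans less_le_trans zero_less_numeral)
  have lc: "ln d \<le> c" using d by (metis ln_exp ln_mono less_le_trans zero_less_numeral)
  have xz: "0 < x * z" using assms by simp
  have \<beta>: "N * y * 2 / (x * z) \<le> \<beta>" "\<beta> \<le> N * y * c / (x * z)"
    unfolding \<beta>_def using ld lc N assms xz
    by (auto intro!: divide_right_mono mult_left_mono)
  have \<beta>1: "2 * d + 40 \<le> \<beta>" using \<beta>(1) e1 d by linarith
  have \<beta>2: "\<beta> \<le> N / 4" using \<beta>(2) e2 by linarith
  have \<beta>0: "0 < \<beta>" using \<beta>1 d by linarith
  have D: "3 \<le> D" "d / 4 - 1 < real D" "real D \<le> d / 4"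
    using d unfolding D_def by linarith+
  have k: "\<beta> / d - 1 \<le> real k" "real k \<le> \<beta> / d"
    using \<beta>0 d unfolding k_def by (auto simp: of_nat_nat)
  have kN: "real k \<le> \<beta> / 12"
    using k(2) d \<beta>0 by (meson divide_left_mono less_imp_le mult_pos_pos less_le_trans order_trans zero_less_numeral)
  have m: "\<beta> / 4130 \<le> real m" "real m \<le> \<beta> / 4130 + 1"
    using \<beta>0 unfolding m_def by linarith+
  have m1: "1 \<le> m" using m(1) \<beta>0 by (cases m) auto
  have l: "y / z \<le> real l" "real l \<le> y / z + 1" using assms unfolding l_def by (auto simp: of_nat_nat)
  have "x / c \<le> x / ln d" using lc ld assms by (intro divide_left_mono) auto
  then have xl: "3 \<le> x / ln d" using e4 by linarith
  have T: "3 * x / ln d + 2 \<le> real T" "real T \<le> 3 * x / ln d + 3"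
  proof -
    have "real T = real_of_int \<lceil>3 * x / ln d\<rceil> + 2" using xl by (simp add: T_def of_nat_nat)
    then show "3 * x / ln d + 2 \<le> real T" "real T \<le> 3 * x / ln d + 3"
      using of_int_ceiling_le_add_one[of "3 * x / ln d"] le_of_int_ceiling[of "3 * x / ln d"] by linarith+
  qed
  have T4: "real T \<le> 4 * x / ln d" "0 < real T" using T xl by auto
  have Dk: "2 * m + 2 \<le> D * k"
  proof -
    have "d / 6 \<le> real D" using D(2) d by linarith
    then have "d / 6 * (\<beta> / d - 1) \<le> d / 6 * real k" using k d by (intro mult_left_mono) auto
    also have "\<dots> \<le> real D * real k" using \<open>d / 6 \<le> real D\<close> by (intro mult_right_mono) auto
    finally have "d / 6 * (\<beta> / d - 1) \<le> real D * real k" .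
    moreover have "d / 6 * (\<beta> / d - 1) = \<beta> / 6 - d / 6" using d by (simp add: field_simps)
    ultimately have "\<beta> / 6 - d / 6 \<le> real D * real k" by simp
    then have "real (2 * m + 2) \<le> real (D * k)" using m(2) \<beta>1 d by simp
    then show ?thesis by (simp only: of_nat_le_iff)
  qed
  have size: "24 * k + 15 * m + 20 \<le> n"
  proof -
    have "real (24 * k + 15 * m + 20) \<le> real n" using kN m(2) \<beta>2 N assms(5) by simp
    then show ?thesis by (simp only: of_nat_le_iff)
  qed
  have pow: "k < D ^ (T - 2)"
  proof -
    have "d < 4 * real D + 4" using D(2) by linarith
    also have "\<dots> = real (4 * D + 4)" by simp
    also have "4 * D + 4 \<le> D ^ 3"
    proof -
      have "3 * 3 * D \<le> D * D * D" using D(1) by (intro mult_mono) auto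
      then show ?thesis using D(1) unfolding power3_eq_cube by linarith
    qed
    finally have "d \<le> real D ^ 3" by (simp add: power3_eq_cube)
    then have "ln d \<le> ln (real D ^ 3)" using d by (intro ln_mono) auto
    also have "\<dots> = 3 * ln (real D)" using D(1) by (simp add: ln_realpow)
    finally have lD: "ln d / 3 \<le> ln (real D)" by simp
    have "x = (3 * x / ln d) * (ln d / 3)" using ld by simp
    also have "\<dots> \<le> real (T - 2) * ln (real D)"
      using T(1) lD ld xl by (intro mult_mono) auto
    finally have "exp x \<le> exp (real (T - 2) * ln (real D))" by simp
    also have "\<dots> = real D ^ (T - 2)" using D(1) by (simp add: exp_of_nat_mult)
    finally have "N \<le> real D ^ (T - 2)" using assms(4) N by simp
    moreover have "real k < N" using kN \<beta>2 N by linarith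
    ultimately have "real k < real (D ^ (T - 2))" unfolding of_nat_power by linarith
    then show ?thesis by (simp only: of_nat_less_iff)
  qed
  have lT: "2 * l \<le> T"
  proof -
    have "3 * x / c \<le> 3 * x / ln d" using lc ld assms by (intro divide_left_mono) auto
    then have "real (2 * l) \<le> real T" using l(2) e3 T(1) by simp
    then show ?thesis by (simp only: of_nat_le_iff)
  qed
  have blocks: "11 * m + 2 * l + 2 \<le> l * ((n div 3) div (4 * T))"
  proof -
    let ?B = "(n div 3) div (4 * T)"
    have "?B = n div (12 * T)" by (simp flip: div_mult2_eq)
    then have "N / (12 * real T) - 1 \<le> real ?B"
      using assms(5) real_div_minus_one_le[of n "12 * T"] by simp
    moreover have "N * ln d / (48 * x) \<le> N / (12 * real T)"
    proof -
      have "N / (12 * (4 * x / ln d)) \<le> N / (12 * real T)"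
        using T4 N ld assms(1) by (intro divide_left_mono mult_pos_pos divide_pos_pos) auto
      then show ?thesis using ld assms by (simp add: field_simps)
    qed
    ultimately have B: "N * ln d / (48 * x) - 3 \<le> real ?B - 2" by linarith
    have "N * 2 / (48 * x) \<le> N * ln d / (48 * x)"
      using ld N assms by (intro divide_right_mono mult_left_mono) auto
    then have B0: "0 \<le> N * ln d / (48 * x) - 3" using e5 by linarith
    have "\<beta> / 48 - 3 * (y / z) = (y / z) * (N * ln d / (48 * x) - 3)"
      using assms xz by (simp add: \<beta>_def field_simps)
    also have "\<dots> \<le> real l * (real ?B - 2)"
      using l B B0 assms by (intro mult_mono) auto
    finally have "\<beta> / 48 - 3 * (y / z) \<le> real l * real ?B - 2 * real l" by (simp add: algebra_simps)
    then have "real (11 * m + 2 * l + 2) \<le> real (l * ?B)"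
      using m(2) e6 \<beta>(1) \<beta>0 by simp
    then show ?thesis by (simp only: of_nat_le_iff)
  qed
  have pairs: "64 ^ l * (4 * m * n) < (n div 3)\<^sup>2"
  proof -
    have "real (64 ^ l) = 64 powr real l" by (simp add: powr_realpow)
    also have "\<dots> \<le> 64 powr (y / z + 1)" using l(2) by simp
    finally have p: "real (64 ^ l) \<le> 64 powr (y / z + 1)" .
    have "real m \<le> N * y * c / (x * z)" using m(2) \<beta>(2) \<beta>1 d by linarith
    then have "real (64 ^ l) * (4 * real m) \<le> 64 powr (y / z + 1) * (4 * (N * y * c / (x * z)))"
      using p by (intro mult_mono) auto
    also have "\<dots> < N / 16" by (rule e7)
    finally have "real (64 ^ l) * (4 * real m) * N < N / 16 * N" using N by simp
    also have "\<dots> = (N / 4)\<^sup>2" by (simp add: power2_eq_square)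
    also have "\<dots> \<le> (real (n div 3))\<^sup>2"
      using N assms(5) real_div_minus_one_le[of n 3] by (intro power_mono) auto
    finally have "real (64 ^ l * (4 * m * n)) < real ((n div 3)\<^sup>2)"
      using assms(5) by (simp add: mult.assoc)
    then show ?thesis by (simp only: of_nat_less_iff)
  qed
  have "admissible n D k m T l"
    unfolding admissible_def using D(1) m1 Dk size pow lT blocks pairs by blast
  then show ?thesis using that k(2) m(1) D(3) by simp
qed

text \<open>In the notation of \<open>rounded_parameters\<close>, the logarithm of \<open>64\<^sup>y\<^sup>/\<^sup>z\<close> is of smaller order than \<open>y\<close>, the logarithm of \<open>ln n\<close>, while \<open>\<beta> / n\<close> is at most
  \<open>(ln n)\<^sup>-\<^sup>2\<^sup>/\<^sup>3\<close> up to factors of lower order.  Here the bound \<open>ln d \<le> (ln n)\<^sup>1\<^sup>/\<^sup>3\<close> enters.\<close>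
lemma eventually_admissible:
  "\<exists>n0 :: nat. \<forall>n \<ge> n0. \<forall>d :: real. 12 \<le> d \<and> d \<le> exp (root 3 (ln (real n))) \<longrightarrow>
    (\<exists>D k m T l. admissible n D k m T l \<and> 4 * real D \<le> d \<and>
      real k \<le> real n * ln (ln (real n)) * ln d / (d * ln (real n) * ln (ln (ln (real n)))) \<and>
      real n * ln (ln (real n)) * ln d / (4130 * ln (real n) * ln (ln (ln (real n)))) \<le> real m)"
proof -
  have e1: "eventually (\<lambda>n::nat. 2 * exp (ln (real n) powr (1/3)) + 40 \<le> real n * ln (ln (real n)) * 2 / (ln (real n) * ln (ln (ln (real n))))) at_top"
    by real_asymp
  have e2: "eventually (\<lambda>n::nat. real n * ln (ln (real n)) * ln (real n) powr (1/3) / (ln (real n) * ln (ln (ln (real n)))) \<le> real n / 4) at_top"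
    by real_asymp
  have e3: "eventually (\<lambda>n::nat. 2 * (ln (ln (real n)) / ln (ln (ln (real n))) + 1) \<le> 3 * ln (real n) / ln (real n) powr (1/3)) at_top"
    by real_asymp
  have e4: "eventually (\<lambda>n::nat. 3 \<le> ln (real n) / ln (real n) powr (1/3)) at_top"
    by real_asymp
  have e5: "eventually (\<lambda>n::nat. 3 \<le> real n * 2 / (48 * ln (real n))) at_top"
    by real_asymp
  have e6: "eventually (\<lambda>n::nat. 13 + 3 * (ln (ln (real n)) / ln (ln (ln (real n)))) \<le> 18 / 1000 * (real n * ln (ln (real n)) * 2 / (ln (real n) * ln (ln (ln (real n)))))) at_top"
    by real_asymp
  have e7: "eventually (\<lambda>n::nat. 64 powr (ln (ln (real n)) / ln (ln (ln (real n))) + 1) * (4 * (real n * ln (ln (real n)) * ln (real n) powr (1/3) / (ln (real n) * ln (ln (ln (real n)))))) < real n / 16) at_top"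
    by real_asymp
  have e8: "eventually (\<lambda>n::nat. 1 \<le> ln (real n) \<and> 1 \<le> ln (ln (real n)) \<and> 1 \<le> ln (ln (ln (real n)))) at_top"
    by (intro eventually_conj; real_asymp)
  have "eventually (\<lambda>n :: nat. \<forall>d :: real. 12 \<le> d \<and> d \<le> exp (root 3 (ln (real n))) \<longrightarrow>
    (\<exists>D k m T l. admissible n D k m T l \<and> 4 * real D \<le> d \<and>
      real k \<le> real n * ln (ln (real n)) * ln d / (d * ln (real n) * ln (ln (ln (real n)))) \<and>
      real n * ln (ln (real n)) * ln d / (4130 * ln (real n) * ln (ln (ln (real n)))) \<le> real m)) at_top"
    using e1 e2 e3 e4 e5 e6 e7 e8 eventually_ge_at_top[of "100 :: nat"]
  proof eventually_elim
    case (elim n)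
    show ?case
    proof (intro allI impI)
      fix d :: real assume d: "12 \<le> d \<and> d \<le> exp (root 3 (ln (real n)))"
      let ?x = "ln (real n)"
      let ?\<beta> = "real n * ln ?x * ln d / (?x * ln (ln ?x))"
      have c: "root 3 ?x = ?x powr (1/3)" "0 < ?x powr (1/3)"
        using elim(8) by (simp_all add: root_powr_inverse)
      obtain D k m T l :: nat where *: "admissible n D k m T l" "4 * real D \<le> d"
        "real k \<le> ?\<beta> / d" "?\<beta> / 4130 \<le> real m"
        by (rule rounded_parameters[of ?x "ln ?x" "ln (ln ?x)" "real n" n d "?x powr (1/3)"])
           (use elim d c in simp_all)
      have "?\<beta> / t = real n * ln ?x * ln d / (t * ?x * ln (ln ?x))" for t :: real
        by (simp add: mult_ac)
      with * show "\<exists>D k m T l. admissible n D k m T l \<and> 4 * real D \<le> d \<and>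
      real k \<le> real n * ln (ln (real n)) * ln d / (d * ln (real n) * ln (ln (ln (real n)))) \<and>
      real n * ln (ln (real n)) * ln d / (4130 * ln (real n) * ln (ln (ln (real n)))) \<le> real m"
        by metis
    qed
  qed
  then show ?thesis unfolding eventually_sequentially .
qed

section \<open>Hamilton-connectedness\<close>

lemma vwalk_arcs_edges: "(x, y) \<in> set (vwalk_arcs p) \<Longrightarrow> {x, y} \<in> edges p"
  by (induction p rule: vwalk_arcs.induct) auto

theorem theorem1p2:
  shows "\<exists>n0 :: nat. \<forall>n \<ge> n0. \<forall>d :: real. 12 \<le> d \<and> d \<le> exp (root 3 (ln (real n))) \<longrightarrow>
    (\<forall>G :: 'a pair_pre_digraph.
       pair_graph G \<and> card (pverts G) = n \<and>
       (\<forall>S. S \<subset> pverts G \<and>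
          real (card S) \<le> real n * ln (ln (real n)) * ln d / (d * ln (real n) * ln (ln (ln (real n))))
          \<longrightarrow> real (card (ext_nbhd G S)) \<ge> d * real (card S)) \<and>
       (\<forall>A B. A \<subseteq> pverts G \<and> B \<subseteq> pverts G \<and> A \<inter> B = {} \<and>
          real (card A) \<ge> real n * ln (ln (real n)) * ln d / (4130 * ln (real n) * ln (ln (ln (real n)))) \<and>
          real (card B) \<ge> real n * ln (ln (real n)) * ln d / (4130 * ln (real n) * ln (ln (ln (real n))))
          \<longrightarrow> (\<exists>a\<in>A. \<exists>b\<in>B. (a, b) \<in> parcs G))
       \<longrightarrow> hamilton_connected G)"
proof -
  obtain n0 :: nat where n0: "\<And>n d. n0 \<le> n \<Longrightarrow> 12 \<le> d \<and> d \<le> exp (root 3 (ln (real n))) \<Longrightarrow>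
    \<exists>D k m T l. admissible n D k m T l \<and> 4 * real D \<le> d \<and>
      real k \<le> real n * ln (ln (real n)) * ln d / (d * ln (real n) * ln (ln (ln (real n)))) \<and>
      real n * ln (ln (real n)) * ln d / (4130 * ln (real n) * ln (ln (ln (real n)))) \<le> real m"
    using eventually_admissible by metis
  show ?thesis
  proof (intro exI[of _ n0] allI impI, elim conjE)
    fix n :: nat and d :: real and G :: "'a pair_pre_digraph"
    assume n: "n0 \<le> n" and d: "12 \<le> d" "d \<le> exp (root 3 (ln (real n)))"
      and G: "pair_graph G" "card (pverts G) = n"
      and P1: "\<forall>S. S \<subset> pverts G \<and>
          real (card S) \<le> real n * ln (ln (real n)) * ln d / (d * ln (real n) * ln (ln (ln (real n))))
          \<longrightarrow> real (card (ext_nbhd G S)) \<ge> d * real (card S)"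
      and P2: "\<forall>A B. A \<subseteq> pverts G \<and> B \<subseteq> pverts G \<and> A \<inter> B = {} \<and>
          real (card A) \<ge> real n * ln (ln (real n)) * ln d / (4130 * ln (real n) * ln (ln (ln (real n)))) \<and>
          real (card B) \<ge> real n * ln (ln (real n)) * ln d / (4130 * ln (real n) * ln (ln (ln (real n))))
          \<longrightarrow> (\<exists>a\<in>A. \<exists>b\<in>B. (a, b) \<in> parcs G)"
    obtain D k m T l :: nat where adm: "admissible n D k m T l" and "4 * real D \<le> d"
      "real k \<le> real n * ln (ln (real n)) * ln d / (d * ln (real n) * ln (ln (ln (real n))))"
      "real n * ln (ln (real n)) * ln d / (4130 * ln (real n) * ln (ln (ln (real n)))) \<le> real m"
      using n0[OF n] d by metis
    note par = this(2-4)
    interpret G: pair_graph G by fact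
    define X where "X = (\<lambda>(x, y). {x, y}) ` parcs G"
    have sym: "(y, x) \<in> parcs G" if "(x, y) \<in> parcs G" for x y
      using G.pair_sym_arcs that by (auto simp: symmetric_def sym_def)
    have X: "{x, y} \<in> X \<longleftrightarrow> (x, y) \<in> parcs G" for x y
      using sym by (auto simp: X_def doubleton_eq_iff image_iff)
    show "hamilton_connected G"
      unfolding hamilton_connected_def
    proof (intro ballI impI)
      fix u v assume uv: "u \<in> pverts G" "v \<in> pverts G" "u \<noteq> v"
      interpret edge_graph "pverts G" X u v
      proof
        fix x y assume "{x, y} \<in> X"
        then have "(x, y) \<in> parcs G" by (simp add: X)
        then show "x \<in> pverts G \<and> y \<in> pverts G \<and> x \<noteq> y"
          using G.arc_fst_in_verts G.arc_snd_in_verts G.pair_no_loops by fastforce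
      qed (use uv G.pair_finite_verts in auto)
      have nbh: "nbh S = ext_nbhd G S" for S by (simp add: nbh_def ext_nbhd_def X)
      interpret expander "pverts G" X u v D k m
      proof
        fix S assume S: "S \<subseteq> pverts G" "card S \<le> k"
        \<comment> \<open>the expansion hypothesis speaks of proper subsets only\<close>
        have "S \<noteq> pverts G" using S(2) adm G(2) by (auto simp: admissible_def)
        moreover have "real (card S) \<le> real k" using S(2) by simp
        ultimately have "d * real (card S) \<le> real (card (ext_nbhd G S))"
          using P1 S par(2) by (meson order_trans psubsetI)
        moreover have "4 * real D * real (card S) \<le> d * real (card S)"
          using par(1) by (intro mult_right_mono) auto
        ultimately have "real (4 * D * card S) \<le> real (card (nbh S))" by (simp add: nbh)
        then show "4 * D * card S \<le> card (nbh S)" by (simp only: of_nat_le_iff)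
      next
        fix A B assume AB: "A \<subseteq> pverts G" "B \<subseteq> pverts G" "A \<inter> B = {}" "m \<le> card A" "m \<le> card B"
        then have "real m \<le> real (card A)" "real m \<le> real (card B)" by simp_all
        then show "\<exists>a\<in>A. \<exists>b\<in>B. {a, b} \<in> X"
          using P2 AB(1-3) par(3) unfolding X by (meson order_trans)
      qed (use adm G in \<open>auto simp: admissible_def\<close>)
      obtain q where q: "distinct q" "set q = pverts G" "edges q \<subseteq> X" "hd q = u" "last q = v"
        using hamilton_path_between adm G(2) by metis
      have "set (vwalk_arcs q) \<subseteq> parcs G" 
        by (auto dest!: vwalk_arcs_edges subsetD[OF q(3)] simp: X)
      then have "hamilton_path G u q v"
        using q uv unfolding hamilton_path_def vpath_def vwalk_def by auto
      then show "\<exists>p. hamilton_path G u p v" by blast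
    qed
  qed
qed

end
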